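(* (GB + AC) Weak Vopěnka's Principle is equivalent to Semi-Weak Vopěnka's Principle.
   Context: The background theory GB + AC is Gödel–Bernays (second-order) set theory, with sets and classes, together with the Axiom of Choice for sets (global choice is not assumed). A graph is a structure $\langle G,E\rangle$ where $G$ is a set and $E$ is an arbitrary binary relation on $G$. A homomorphism from $\langle G,E\rangle$ to $\langle G',E'\rangle$ is a function $h: G\to G'$ such that $\langle v,w\rangle\in E$ implies $\langle h(v),h(w)\rangle\in E'$. Weak Vopěnka's Principle (WVP): no (class) sequence of graphs $\langle G_\alpha:\alpha\in\mathrm{Ord}\rangle$ has both of the following properties: whenever $\alpha\le\alpha'$ there is a unique homomorphism $G_{\alpha'}\to G_\alpha$, and whenever $\alpha<\alpha'$ there is no homomorphism $G_\alpha\to G_{\alpha'}$. Semi-Weak Vopěnka's Principle (SWVP): no (class) sequence of graphs $\langle G_\alpha:\alpha\in\mathrm{Ord}\rangle$ has both of the following properties: whenever $\alpha\le\alpha'$ there is a homomorphism $G_{\alpha'}\to G_\alpha$ (not necessarily unique), and whenever $\alpha<\alpha'$ there is no homomorphism $G_\alpha\to G_{\alpha'}$. *)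

theory Defs
  imports Main
begin

text \<open>
  Goedel-Bernays class theory is not a theory in HOL, so it is rendered model-theoretically: the
  type \<open>'c\<close> is the collection of all classes of a model, \<open>\<epsilon>\<close> is its membership relation, and every
  set-theoretic notion below is the usual first-order one, interpreted in that model. A statement
  holds in every such model iff it is a theorem of the theory. Sets are the classes that are
  members of some class; there are no urelements.
\<close>

text \<open>
  Formulas of the language of class theory, with variables named by natural numbers. \<open>All_Set\<close>
  is a quantifier over sets; there is no quantifier over classes, so these are exactly
  the predicative formulas, for which GB has class comprehension.
\<close>

datatype fm =
    Mem nat nat
  | Eq nat nat
  | Neg fm
  | Conj fm fm
  | All_Set nat fm

locale class_structure =
  fixes mem :: "'c \<Rightarrow> 'c \<Rightarrow> bool" (infix "\<epsilon>" 50)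
begin

definition is_set :: "'c \<Rightarrow> bool" where
  "is_set x \<longleftrightarrow> (\<exists>X. x \<epsilon> X)"

primrec sat :: "(nat \<Rightarrow> 'c) \<Rightarrow> fm \<Rightarrow> bool" where
  "sat e (Mem i j) \<longleftrightarrow> e i \<epsilon> e j"
| "sat e (Eq i j) \<longleftrightarrow> e i = e j"
| "sat e (Neg \<phi>) \<longleftrightarrow> \<not> sat e \<phi>"
| "sat e (Conj \<phi> \<psi>) \<longleftrightarrow> sat e \<phi> \<and> sat e \<psi>"
| "sat e (All_Set i \<phi>) \<longleftrightarrow> (\<forall>x. is_set x \<longrightarrow> sat (e(i := x)) \<phi>)"

definition is_subclass :: "'c \<Rightarrow> 'c \<Rightarrow> bool" where
  "is_subclass X Y \<longleftrightarrow> (\<forall>z. z \<epsilon> X \<longrightarrow> z \<epsilon> Y)"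

definition is_upair :: "'c \<Rightarrow> 'c \<Rightarrow> 'c \<Rightarrow> bool" where
  "is_upair z x y \<longleftrightarrow> is_set x \<and> is_set y \<and> (\<forall>u. u \<epsilon> z \<longleftrightarrow> u = x \<or> u = y)"

text \<open>\<open>is_opair p x y\<close>: \<open>p\<close> is the Kuratowski pair \<open>{{x}, {x, y}}\<close>.\<close>

definition is_opair :: "'c \<Rightarrow> 'c \<Rightarrow> 'c \<Rightarrow> bool" where
  "is_opair p x y \<longleftrightarrow> (\<exists>a b. is_upair a x x \<and> is_upair b x y \<and> is_upair p a b)"

definition pair_in :: "'c \<Rightarrow> 'c \<Rightarrow> 'c \<Rightarrow> bool" where
  "pair_in R x y \<longleftrightarrow> (\<exists>p. is_opair p x y \<and> p \<epsilon> R)"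

text \<open>
  The domain is given as a predicate so that the same notion covers functions on a set and
  class functions on the ordinals.
\<close>

definition function_on :: "'c \<Rightarrow> ('c \<Rightarrow> bool) \<Rightarrow> bool" where
  "function_on F D \<longleftrightarrow>
     (\<forall>p. p \<epsilon> F \<longrightarrow> (\<exists>x y. D x \<and> is_opair p x y)) \<and>
     (\<forall>x. D x \<longrightarrow> (\<exists>!y. pair_in F x y))"

definition is_map :: "'c \<Rightarrow> 'c \<Rightarrow> 'c \<Rightarrow> bool" where
  "is_map f A B \<longleftrightarrow>
     is_set f \<and> function_on f (\<lambda>x. x \<epsilon> A) \<and> (\<forall>x y. pair_in f x y \<longrightarrow> y \<epsilon> B)"

text \<open>An ordinal is a transitive set well-ordered by membership.\<close>

definition is_ord :: "'c \<Rightarrow> bool" where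
  "is_ord a \<longleftrightarrow>
     is_set a \<and>
     (\<forall>x. x \<epsilon> a \<longrightarrow> is_subclass x a) \<and>
     (\<forall>x. x \<epsilon> a \<longrightarrow> \<not> x \<epsilon> x) \<and>
     (\<forall>x y z. x \<epsilon> a \<and> y \<epsilon> a \<and> z \<epsilon> a \<and> x \<epsilon> y \<and> y \<epsilon> z \<longrightarrow> x \<epsilon> z) \<and>
     (\<forall>x y. x \<epsilon> a \<and> y \<epsilon> a \<longrightarrow> x \<epsilon> y \<or> x = y \<or> y \<epsilon> x) \<and>
     (\<forall>s. is_set s \<and> is_subclass s a \<and> (\<exists>x. x \<epsilon> s) \<longrightarrow>
        (\<exists>m. m \<epsilon> s \<and> (\<forall>y. y \<epsilon> s \<longrightarrow> m = y \<or> m \<epsilon> y)))"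

definition ord_le :: "'c \<Rightarrow> 'c \<Rightarrow> bool" where
  "ord_le a b \<longleftrightarrow> a \<epsilon> b \<or> a = b"

text \<open>
  \<open>graph_parts g G E\<close>: \<open>g\<close> is the graph \<open>\<langle>G, E\<rangle>\<close>. That \<open>G\<close> and \<open>E\<close> are sets is part of
  \<open>is_opair\<close>.
\<close>

definition graph_parts :: "'c \<Rightarrow> 'c \<Rightarrow> 'c \<Rightarrow> bool" where
  "graph_parts g G E \<longleftrightarrow>
     is_opair g G E \<and>
     (\<forall>p. p \<epsilon> E \<longrightarrow> (\<exists>v w. v \<epsilon> G \<and> w \<epsilon> G \<and> is_opair p v w))"

definition is_graph :: "'c \<Rightarrow> bool" where
  "is_graph g \<longleftrightarrow> (\<exists>G E. graph_parts g G E)"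

definition is_hom :: "'c \<Rightarrow> 'c \<Rightarrow> 'c \<Rightarrow> bool" where
  "is_hom h g g' \<longleftrightarrow>
     (\<exists>G E G' E'. graph_parts g G E \<and> graph_parts g' G' E' \<and> is_map h G G' \<and>
        (\<forall>v w v' w'. pair_in E v w \<and> pair_in h v v' \<and> pair_in h w w' \<longrightarrow> pair_in E' v' w'))"

text \<open>A class sequence of graphs indexed by all ordinals; \<open>pair_in S a g\<close> says \<open>G\<^sub>a = g\<close>.\<close>

definition graph_sequence :: "'c \<Rightarrow> bool" where
  "graph_sequence S \<longleftrightarrow>
     function_on S is_ord \<and> (\<forall>a g. pair_in S a g \<longrightarrow> is_graph g)"

definition WVP :: bool where
  "WVP \<longleftrightarrow>
     \<not> (\<exists>S. graph_sequence S \<and>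
          (\<forall>a b g g'. is_ord a \<and> is_ord b \<and> ord_le a b \<and> pair_in S a g \<and> pair_in S b g' \<longrightarrow>
             (\<exists>!h. is_hom h g' g)) \<and>
          (\<forall>a b g g'. is_ord a \<and> is_ord b \<and> a \<epsilon> b \<and> pair_in S a g \<and> pair_in S b g' \<longrightarrow>
             \<not> (\<exists>h. is_hom h g g')))"

definition SWVP :: bool where
  "SWVP \<longleftrightarrow>
     \<not> (\<exists>S. graph_sequence S \<and>
          (\<forall>a b g g'. is_ord a \<and> is_ord b \<and> ord_le a b \<and> pair_in S a g \<and> pair_in S b g' \<longrightarrow>
             (\<exists>h. is_hom h g' g)) \<and>
          (\<forall>a b g g'. is_ord a \<and> is_ord b \<and> a \<epsilon> b \<and> pair_in S a g \<and> pair_in S b g' \<longrightarrow>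
             \<not> (\<exists>h. is_hom h g g')))"

end

text \<open>
  In \<open>comprehension\<close> the environment \<open>e\<close> supplies arbitrary class parameters. Replacement is for
  possibly partial class functions, so it includes Separation.
\<close>

locale GB = class_structure mem for mem :: "'c \<Rightarrow> 'c \<Rightarrow> bool" (infix "\<epsilon>" 50) +
  assumes extensionality: "(\<And>z. z \<epsilon> X \<longleftrightarrow> z \<epsilon> Y) \<Longrightarrow> X = Y"
    and comprehension: "\<exists>X. \<forall>x. x \<epsilon> X \<longleftrightarrow> is_set x \<and> sat (e(0 := x)) \<phi>"
    and pairing: "is_set x \<Longrightarrow> is_set y \<Longrightarrow> \<exists>z. is_set z \<and> is_upair z x y"
    and union: "is_set a \<Longrightarrow> \<exists>u. is_set u \<and> (\<forall>x. x \<epsilon> u \<longleftrightarrow> (\<exists>y. x \<epsilon> y \<and> y \<epsilon> a))"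
    and power_set: "is_set a \<Longrightarrow> \<exists>u. is_set u \<and> (\<forall>x. x \<epsilon> u \<longleftrightarrow> is_set x \<and> is_subclass x a)"
    and infinity:
      "\<exists>w. is_set w \<and> (\<exists>z. z \<epsilon> w \<and> (\<forall>u. \<not> u \<epsilon> z)) \<and>
         (\<forall>x. x \<epsilon> w \<longrightarrow> (\<exists>y. y \<epsilon> w \<and> (\<forall>u. u \<epsilon> y \<longleftrightarrow> u \<epsilon> x \<or> u = x)))"
    and replacement:
      "is_set a \<Longrightarrow> (\<And>x y y'. pair_in F x y \<Longrightarrow> pair_in F x y' \<Longrightarrow> y = y') \<Longrightarrow>
         \<exists>u. is_set u \<and> (\<forall>y. y \<epsilon> u \<longleftrightarrow> (\<exists>x. x \<epsilon> a \<and> pair_in F x y))"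
    and foundation: "x \<epsilon> X \<Longrightarrow> \<exists>m. m \<epsilon> X \<and> (\<forall>y. y \<epsilon> m \<longrightarrow> \<not> y \<epsilon> X)"

text \<open>Choice is postulated for sets only: every set of nonempty sets has a choice function.\<close>

locale GB_AC = GB mem for mem :: "'c \<Rightarrow> 'c \<Rightarrow> bool" (infix "\<epsilon>" 50) +
  assumes choice:
    "is_set a \<Longrightarrow> (\<And>x. x \<epsilon> a \<Longrightarrow> \<exists>y. y \<epsilon> x) \<Longrightarrow>
       \<exists>f. is_set f \<and> function_on f (\<lambda>x. x \<epsilon> a) \<and> (\<forall>x y. pair_in f x y \<longrightarrow> y \<epsilon> x)"

end

theory Submission
  imports Defs
begin

text \<open>
  Let \<open>\<langle>G\<^sub>a\<rangle>\<close> be a counterexample to SWVP. Call a level \<open>A\<close> of the cumulative hierarchy closed if it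
  contains the pairs \<open>\<langle>c, y\<rangle>\<close> with \<open>c\<close> an ordinal in \<open>A\<close> and \<open>y\<close> a vertex of \<open>G\<^bsub>c+1\<^esub>\<close>. To such an \<open>A\<close>
  belongs a structure with two sorts: the points are the elements of \<open>A\<close> and a top point, which is \<open>A\<close>
  itself; the parts are the subsets of \<open>A\<close>. It records membership and non-membership, which parts
  are sections over which points (choosing one vertex of \<open>G\<^bsub>c+1\<^esub>\<close> for each ordinal \<open>c\<close> below the rank of
  the point), and which parts are fiberwise adjacent in these graphs. For \<open>A \<in> B\<close>, truncation
  (send points outside \<open>A\<close> to the top, intersect parts with \<open>A\<close>) is a homomorphism from the structure
  of \<open>B\<close> to that of \<open>A\<close>.

  Conversely every homomorphism between such structures is the truncation. It cannot raise ranks: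
  if a point of rank \<open>d\<close> were sent to one of larger rank, take a vertex \<open>u\<close> of \<open>G\<^sub>d\<close>, form the section of
  its images in all \<open>G\<^bsub>c+1\<^esub>\<close> with \<open>c < d\<close>, apply the homomorphism, and evaluate at \<open>d\<close>; this is a
  homomorphism from \<open>G\<^sub>d\<close> to \<open>G\<^bsub>d+1\<^esub>\<close>. It cannot lower ranks, because membership in a point other than
  the top is preserved. By induction on rank all points are then truncated, and hence so are
  the parts. In particular there is no homomorphism from the structure of \<open>A\<close> to that of \<open>B\<close> when
  \<open>A \<in> B\<close>, because the top point would have to stay the top point and so to rise in rank. Coding these
  structures as graphs along an increasing sequence of closed levels refutes WVP.
\<close>

section \<open>Definability\<close>

primrec rename :: "(nat \<Rightarrow> nat) \<Rightarrow> fm \<Rightarrow> fm" where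
  "rename r (Mem i j) = Mem (r i) (r j)"
| "rename r (Eq i j) = Eq (r i) (r j)"
| "rename r (Neg \<phi>) = Neg (rename r \<phi>)"
| "rename r (Conj \<phi> \<psi>) = Conj (rename r \<phi>) (rename r \<psi>)"
| "rename r (All_Set i \<phi>) = All_Set (r i) (rename r \<phi>)"

text \<open>The list carries the set variables, and the class parameters \<open>e\<close> follow
  behind. Quantifiers prepend their variable, so in the closure rules \<open>hd xs\<close> is the
  innermost one.\<close>

definition env :: "'c list \<Rightarrow> (nat \<Rightarrow> 'c) \<Rightarrow> nat \<Rightarrow> 'c" where
  "env xs e i = (if i < length xs then xs ! i else e (i - length xs))"

lemma env_less [simp]: "i < length xs \<Longrightarrow> env xs e i = xs ! i"
  and env_ge [simp]: "env xs e (length xs + i) = e i"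
  by (simp_all add: env_def)

lemma env_eqI:
  assumes "\<And>i. i < length xs \<Longrightarrow> f i = xs ! i" "\<And>i. f (length xs + i) = e i"
  shows "f = env xs e"
proof
  fix i show "f i = env xs e i"
    using assms(1)[of i] assms(2)[of "i - length xs"] by (cases "i < length xs") (simp_all add: env_def)
qed

text \<open>Closure rules for definability, collected so that \<open>intro dfn\<close> builds the
  formula for an expression by following its syntax.\<close>

named_theorems dfn

context class_structure
begin

text \<open>Injectivity of \<open>r\<close> keeps a renamed bound variable from capturing another
  variable.\<close>

lemma sat_rename: "inj r \<Longrightarrow> sat e (rename r \<phi>) \<longleftrightarrow> sat (e \<circ> r) \<phi>"
proof (induction \<phi> arbitrary: e)
  case (All_Set i \<phi>)
  have "(e(r i := x)) \<circ> r = (e \<circ> r)(i := x)" for x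
    using All_Set.prems by (auto simp: fun_eq_iff inj_eq)
  then show ?case using All_Set by (simp del: fun_upd_apply o_apply)
qed auto

abbreviation sets_list :: "nat \<Rightarrow> 'c list \<Rightarrow> bool" where
  "sets_list n xs \<equiv> length xs = n \<and> (\<forall>x\<in>set xs. is_set x)"

text \<open>Arbitrary classes may occur in \<open>P\<close>: they are the parameters supplied by \<open>e\<close>.\<close>

definition definable :: "nat \<Rightarrow> ('c list \<Rightarrow> bool) \<Rightarrow> bool" where
  "definable n P \<longleftrightarrow> (\<exists>\<phi> e. \<forall>xs. sets_list n xs \<longrightarrow> (sat (env xs e) \<phi> \<longleftrightarrow> P xs))"

text \<open>By extensionality, a definable membership relation determines the class-valued term \<open>t\<close>.\<close>

definition dterm :: "nat \<Rightarrow> ('c list \<Rightarrow> 'c) \<Rightarrow> bool" where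
  "dterm n t \<longleftrightarrow> definable (Suc n) (\<lambda>xs. hd xs \<epsilon> t (tl xs))"

lemma definable_cong:
  "definable n P \<Longrightarrow> (\<And>xs. sets_list n xs \<Longrightarrow> P xs \<longleftrightarrow> Q xs) \<Longrightarrow> definable n Q"
  unfolding definable_def by metis

text \<open>Weakening and permutation of arguments. Distinctness of \<open>s\<close> makes the
  renaming injective; the parameters move from position \<open>m\<close> on to position
  \<open>n\<close> on.\<close>

lemma definable_subst:
  assumes P: "definable m P" and s: "length s = m" "distinct s" "set s \<subseteq> {..<n}"
  shows "definable n (\<lambda>xs. P (map (\<lambda>i. xs ! i) s))"
proof -
  obtain \<phi> e where \<phi>: "\<And>xs. sets_list m xs \<Longrightarrow> sat (env xs e) \<phi> \<longleftrightarrow> P xs"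
    using P unfolding definable_def by blast
  define r where "r i = (if i < m then s ! i else n + (i - m))" for i
  have sn: "s ! i < n" if "i < m" for i using s that nth_mem by fastforce
  have "inj r"
  proof (rule injI)
    fix i j assume "r i = r j"
    then show "i = j"
      using sn[of i] sn[of j] s nth_eq_iff_index_eq[of s i j]
      by (auto simp: r_def split: if_splits)
  qed
  show ?thesis unfolding definable_def
  proof (intro exI allI impI)
    fix xs assume xs: "sets_list n xs"
    have "env xs e \<circ> r = env (map (\<lambda>i. xs ! i) s) e"
      using xs s sn by (intro env_eqI) (auto simp: r_def)
    moreover have "sets_list m (map (\<lambda>i. xs ! i) s)"
      using xs s by (auto simp: subset_iff)
    ultimately show "sat (env xs e) (rename r \<phi>) \<longleftrightarrow> P (map (\<lambda>i. xs ! i) s)"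
      using sat_rename[OF \<open>inj r\<close>] \<phi> by simp
  qed
qed

lemma definable_const [dfn]: "definable n (\<lambda>xs. b)"
proof (cases b)
  case True
  then show ?thesis unfolding definable_def by (intro exI[of _ "Eq 0 0"]) simp
next
  case False
  then show ?thesis unfolding definable_def by (intro exI[of _ "Neg (Eq 0 0)"]) simp
qed

lemma definable_neg [dfn]: "definable n P \<Longrightarrow> definable n (\<lambda>xs. \<not> P xs)"
  unfolding definable_def by (metis sat.simps(3))

text \<open>The two formulas come with different class parameters, which are interleaved: even slots
  serve \<open>P\<close>, odd slots serve \<open>Q\<close>.\<close>

lemma definable_conj [dfn]:
  assumes "definable n P" "definable n Q"
  shows "definable n (\<lambda>xs. P xs \<and> Q xs)"
proof -
  obtain \<phi> e where \<phi>: "\<And>xs. sets_list n xs \<Longrightarrow> sat (env xs e) \<phi> \<longleftrightarrow> P xs"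
    using assms(1) unfolding definable_def by blast
  obtain \<psi> e' where \<psi>: "\<And>xs. sets_list n xs \<Longrightarrow> sat (env xs e') \<psi> \<longleftrightarrow> Q xs"
    using assms(2) unfolding definable_def by blast
  define d where "d i = (if even i then e (i div 2) else e' (i div 2))" for i :: nat
  define r r' where "r i = (if i < n then i else n + 2 * (i - n))"
    and "r' i = (if i < n then i else n + (2 * (i - n) + 1))" for i :: nat
  have inj: "inj r" "inj r'"
    by (auto simp: inj_def r_def r'_def split: if_splits)
  show ?thesis unfolding definable_def
  proof (intro exI allI impI)
    fix xs assume xs: "sets_list n xs"
    have "env xs d \<circ> r = env xs e"
      using xs by (intro env_eqI) (auto simp: r_def env_def d_def)
    moreover have "env xs d \<circ> r' = env xs e'"
      using xs by (intro env_eqI) (auto simp: r'_def env_def d_def)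
    ultimately show "sat (env xs d) (Conj (rename r \<phi>) (rename r' \<psi>)) \<longleftrightarrow> P xs \<and> Q xs"
      using sat_rename inj \<phi>[OF xs] \<psi>[OF xs] by simp
  qed
qed

lemma definable_all_set [dfn]:
  assumes "definable (Suc n) (\<lambda>xs. P (tl xs) (hd xs))"
  shows "definable n (\<lambda>xs. \<forall>x. is_set x \<longrightarrow> P xs x)"
proof -
  obtain \<phi> e where \<phi>: "\<And>xs. sets_list (Suc n) xs \<Longrightarrow> sat (env xs e) \<phi> \<longleftrightarrow> P (tl xs) (hd xs)"
    using assms unfolding definable_def by blast
  \<comment> \<open>The quantified variable moves from slot 0 to slot \<open>n\<close>, just behind
    the arguments; the parameters behind it stay in place.\<close>
  define r where "r i = (if i = 0 then n else if i \<le> n then i - 1 else i)" for i :: nat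
  have inj: "inj r" by (auto simp: inj_def r_def split: if_splits)
  show ?thesis unfolding definable_def
  proof (intro exI allI impI)
    fix xs assume xs: "sets_list n xs"
    let ?d = "env xs (\<lambda>i. e (i - 1))"
    have "(?d(n := x)) \<circ> r = env (x # xs) e" for x
      using xs by (intro env_eqI) (auto simp: r_def env_def nth_Cons split: nat.split)
    then show "sat ?d (All_Set n (rename r \<phi>)) \<longleftrightarrow> (\<forall>x. is_set x \<longrightarrow> P xs x)"
      using sat_rename[OF inj] \<phi>[of "_ # xs"] xs by simp
  qed
qed

lemma definable_imp [dfn]:
  assumes "definable n P" "definable n Q" shows "definable n (\<lambda>xs. P xs \<longrightarrow> Q xs)"
  by (rule definable_cong[OF definable_neg[OF definable_conj[OF assms(1) definable_neg[OF assms(2)]]]]) simp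

lemma definable_disj [dfn]:
  assumes "definable n P" "definable n Q" shows "definable n (\<lambda>xs. P xs \<or> Q xs)"
  by (rule definable_cong[OF definable_imp[OF definable_neg[OF assms(1)] assms(2)]]) auto

lemma definable_iff [dfn]:
  assumes "definable n P" "definable n Q" shows "definable n (\<lambda>xs. P xs \<longleftrightarrow> Q xs)"
  by (rule definable_cong[OF definable_conj[OF definable_imp[OF assms] definable_imp[OF assms(2,1)]]])
    auto

lemma definable_ex_set [dfn]:
  assumes "definable (Suc n) (\<lambda>xs. P (tl xs) (hd xs))"
  shows "definable n (\<lambda>xs. \<exists>x. is_set x \<and> P xs x)"
  by (rule definable_cong[OF definable_neg[OF definable_all_set[OF definable_neg[OF assms]]]]) auto

text \<open>A finite disjunction of formulas: \<open>k\<close> is a natural number of the metatheory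
  and may affect the shape of the formula.\<close>

lemma definable_less [dfn]:
  "(\<And>k. k < m \<Longrightarrow> definable n (\<lambda>xs. P xs k)) \<Longrightarrow> definable n (\<lambda>xs. \<exists>k<m. P xs k)" for m :: nat
proof (induction m)
  case 0
  then show ?case using definable_const[of n False] by simp
next
  case (Suc m)
  have "definable n (\<lambda>xs. P xs m \<or> (\<exists>k<m. P xs k))"
    using Suc by (intro definable_disj) auto
  then show ?case by (rule definable_cong) (auto simp: less_Suc_eq)
qed

section \<open>Definability of class-valued terms\<close>

lemma dterm_subst:
  assumes t: "dterm m t" and s: "length s = m" "distinct s" "set s \<subseteq> {..<n}"
  shows "dterm n (\<lambda>xs. t (map (\<lambda>i. xs ! i) s))"
  unfolding dterm_def
proof (rule definable_cong[OF definable_subst[OF t[unfolded dterm_def], of "0 # map Suc s" "Suc n"]])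
  fix xs :: "'c list" assume "sets_list (Suc n) xs"
  then show "(hd (map (\<lambda>i. xs ! i) (0 # map Suc s)) \<epsilon> t (tl (map (\<lambda>i. xs ! i) (0 # map Suc s)))) \<longleftrightarrow>
      hd xs \<epsilon> t (map (\<lambda>i. tl xs ! i) s)"
    using s by (cases xs) (auto simp: comp_def)
qed (use s in \<open>auto simp: distinct_map\<close>)

lemma dterm_cong:
  "dterm n t \<Longrightarrow> (\<And>xs. sets_list n xs \<Longrightarrow> t xs = u xs) \<Longrightarrow> dterm n u"
  unfolding dterm_def by (erule definable_cong) (auto simp: length_Suc_conv)

lemma dterm_unary:
  assumes "dterm (Suc 0) (\<lambda>xs. f (hd xs))" shows "dterm (Suc n) (\<lambda>xs. f (hd xs))"
  by (rule dterm_cong[OF dterm_subst[OF assms, of "[0]"]]) (auto simp: length_Suc_conv)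

text \<open>Needed where \<open>f\<close> is evaluated at a variable bound inside a comprehension:
  the variable of the comprehension itself has to be skipped.\<close>

lemma dterm_skip:
  assumes "dterm (Suc n) (\<lambda>xs. f (tl xs) (hd xs))"
  shows "dterm (Suc (Suc n)) (\<lambda>xs. f (tl (tl xs)) (hd xs))"
proof (rule dterm_cong[OF dterm_subst[OF assms, of "0 # [2..<Suc (Suc n)]"]])
  fix xs :: "'c list" assume xs: "sets_list (Suc (Suc n)) xs"
  have "map (\<lambda>i. xs ! i) [2..<Suc (Suc n)] = tl (tl xs)"
    using xs by (intro nth_equalityI) (auto simp: nth_tl simp del: upt_Suc)
  moreover have "hd xs = xs ! 0" using xs by (cases xs) auto
  ultimately show "f (tl (map (\<lambda>i. xs ! i) (0 # [2..<Suc (Suc n)]))) (hd (map (\<lambda>i. xs ! i) (0 # [2..<Suc (Suc n)]))) =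
      f (tl (tl xs)) (hd xs)" by simp
qed auto

lemma dterm_weaken [dfn]:
  assumes "dterm n t" shows "dterm (Suc n) (\<lambda>xs. t (tl xs))"
proof (rule dterm_cong[OF dterm_subst[OF assms, of "[1..<Suc n]" "Suc n"]])
  fix xs :: "'c list" assume "sets_list (Suc n) xs"
  then have "map (\<lambda>i. xs ! i) [1..<Suc n] = tl xs"
    by (intro nth_equalityI) (auto simp: nth_tl simp del: upt_Suc)
  then show "t (map (\<lambda>i. xs ! i) [1..<Suc n]) = t (tl xs)" by simp
qed auto

lemma dterm_hd [dfn]: "dterm (Suc n) (\<lambda>xs. hd xs)"
  unfolding dterm_def definable_def
proof (intro exI allI impI)
  fix xs :: "'c list" assume xs: "sets_list (Suc (Suc n)) xs"
  then obtain x y ys where "xs = x # y # ys" by (metis length_Suc_conv)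
  then show "sat (env xs (\<lambda>_. undefined)) (Mem 0 1) \<longleftrightarrow> hd xs \<epsilon> hd (tl xs)"
    by (simp add: env_def)
qed

lemma dterm_const [dfn]: "dterm n (\<lambda>xs. C)"
  unfolding dterm_def definable_def
proof (intro exI allI impI)
  fix xs :: "'c list" assume xs: "sets_list (Suc n) xs"
  then obtain x ys where "xs = x # ys" by (metis length_Suc_conv)
  \<comment> \<open>Slot \<open>Suc n\<close> is the first one behind the set variables; it holds
    the parameter \<open>C\<close>, which may be a proper class.\<close>
  then show "sat (env xs (\<lambda>_. C)) (Mem 0 (Suc n)) \<longleftrightarrow> hd xs \<epsilon> C"
    using xs by (simp add: env_def)
qed

text \<open>Set arguments that are held fixed become parameters, which leaves the single free
  variable that comprehension requires.\<close>

lemma definable_at: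
  assumes "definable (Suc n) P" "sets_list n xs"
  shows "definable (Suc 0) (\<lambda>ys. P (hd ys # xs))"
proof -
  obtain \<phi> e where \<phi>: "\<And>xs. sets_list (Suc n) xs \<Longrightarrow> sat (env xs e) \<phi> \<longleftrightarrow> P xs"
    using assms(1) unfolding definable_def by blast
  show ?thesis unfolding definable_def
  proof (intro exI allI impI)
    fix ys assume ys: "sets_list (Suc 0) ys"
    then obtain y where y: "ys = [y]" by (auto simp: length_Suc_conv)
    have "env ys (env xs e) = env (y # xs) e"
      using assms(2) unfolding y by (intro env_eqI) (auto simp: env_def nth_Cons split: nat.split)
    then show "sat (env ys (env xs e)) \<phi> \<longleftrightarrow> P (hd ys # xs)"
      using \<phi>[of "y # xs"] y ys assms(2) by simp
  qed
qed

text \<open>Total on predicates, but meaningful for definable \<open>P\<close>, where comprehension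
  gives existence and extensionality uniqueness.\<close>

definition Coll :: "('c \<Rightarrow> bool) \<Rightarrow> 'c" where
  "Coll P = (THE X. \<forall>x. x \<epsilon> X \<longleftrightarrow> is_set x \<and> P x)"

lemma is_setI: "x \<epsilon> X \<Longrightarrow> is_set x"
  by (auto simp: is_set_def)

end

context GB
begin

lemma mem_Coll:
  assumes "definable (Suc 0) (\<lambda>xs. P (hd xs))"
  shows "x \<epsilon> Coll P \<longleftrightarrow> is_set x \<and> P x"
proof -
  obtain \<phi> e where \<phi>: "\<And>xs. sets_list (Suc 0) xs \<Longrightarrow> sat (env xs e) \<phi> \<longleftrightarrow> P (hd xs)"
    using assms unfolding definable_def by blast
  \<comment> \<open>The entry \<open>undefined\<close> merely reserves slot 0, which comprehension
    overwrites.\<close>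
  obtain X where X: "\<And>x. x \<epsilon> X \<longleftrightarrow> is_set x \<and> sat ((env [undefined] e)(0 := x)) \<phi>"
    using comprehension by blast
  have "(env [undefined] e)(0 := x) = env [x] e" for x
    by (auto simp: env_def)
  then have X: "\<forall>x. x \<epsilon> X \<longleftrightarrow> is_set x \<and> P x"
    using X \<phi>[of "[_]"] by auto
  moreover have "Coll P = X" unfolding Coll_def
    using X by (intro the_equality) (auto intro: extensionality)
  ultimately show ?thesis by blast
qed

lemma dterm_Coll [dfn]:
  assumes "definable (Suc n) (\<lambda>xs. P (tl xs) (hd xs))"
  shows "dterm n (\<lambda>xs. Coll (P xs))"
  unfolding dterm_def
proof (rule definable_cong[OF assms])
  fix xs :: "'c list" assume xs: "sets_list (Suc n) xs"
  then obtain y ys where y: "xs = y # ys" "sets_list n ys" by (auto simp: length_Suc_conv)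
  have "definable (Suc 0) (\<lambda>zs. P ys (hd zs))"
    using definable_at[OF assms y(2)] by simp
  then show "P (tl xs) (hd xs) \<longleftrightarrow> hd xs \<epsilon> Coll (P (tl xs))"
    using mem_Coll xs y by simp
qed

lemma eqI: "(\<And>z. is_set z \<Longrightarrow> z \<epsilon> X \<longleftrightarrow> z \<epsilon> Y) \<Longrightarrow> X = Y"
  by (metis extensionality is_setI)

text \<open>A term may denote a proper class, so membership of its value is expressed through a set
  \<open>y\<close> with the same elements.\<close>

lemma definable_mem [dfn]:
  assumes t: "dterm n t" and u: "dterm n u" shows "definable n (\<lambda>xs. t xs \<epsilon> u xs)"
proof -
  have 1: "definable (Suc (Suc n)) (\<lambda>xs. hd xs \<epsilon> t (tl (tl xs)))"
    using dterm_weaken[OF t] unfolding dterm_def by simp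
  have 2: "definable (Suc (Suc n)) (\<lambda>xs. hd xs \<epsilon> hd (tl xs))"
    using dterm_hd[of n] unfolding dterm_def by simp
  have "definable n (\<lambda>xs. \<exists>y. is_set y \<and> (\<forall>z. is_set z \<longrightarrow> (z \<epsilon> y \<longleftrightarrow> z \<epsilon> t xs)) \<and> y \<epsilon> u xs)"
    using u unfolding dterm_def
    by (intro definable_ex_set definable_conj definable_all_set definable_iff 1 2) auto
  moreover have "(\<exists>y. is_set y \<and> (\<forall>z. is_set z \<longrightarrow> (z \<epsilon> y \<longleftrightarrow> z \<epsilon> t xs)) \<and> y \<epsilon> u xs) \<longleftrightarrow> t xs \<epsilon> u xs" for xs
    by (metis eqI is_setI)
  ultimately show ?thesis by simp
qed

lemma definable_eq [dfn]:
  assumes t: "dterm n t" and u: "dterm n u" shows "definable n (\<lambda>xs. t xs = u xs)"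
proof -
  have "definable n (\<lambda>xs. \<forall>z. is_set z \<longrightarrow> (z \<epsilon> t xs \<longleftrightarrow> z \<epsilon> u xs))"
    using t u unfolding dterm_def by (intro definable_all_set definable_iff) auto
  moreover have "(\<forall>z. is_set z \<longrightarrow> (z \<epsilon> t xs \<longleftrightarrow> z \<epsilon> u xs)) \<longleftrightarrow> t xs = u xs" for xs
    by (metis eqI)
  ultimately show ?thesis by simp
qed

lemma definable_ball [dfn]:
  assumes "dterm n a" "definable (Suc n) (\<lambda>xs. P (tl xs) (hd xs))"
  shows "definable n (\<lambda>xs. \<forall>x. x \<epsilon> a xs \<longrightarrow> P xs x)"
proof -
  have "definable n (\<lambda>xs. \<forall>x. is_set x \<longrightarrow> x \<epsilon> a xs \<longrightarrow> P xs x)"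
    using assms by (intro dfn)
  then show ?thesis by (rule definable_cong) (auto dest: is_setI)
qed

lemma definable_bex [dfn]:
  assumes "dterm n a" "definable (Suc n) (\<lambda>xs. P (tl xs) (hd xs))"
  shows "definable n (\<lambda>xs. \<exists>x. x \<epsilon> a xs \<and> P xs x)"
proof -
  have "definable n (\<lambda>xs. \<exists>x. is_set x \<and> x \<epsilon> a xs \<and> P xs x)"
    using assms by (intro dfn)
  then show ?thesis by (rule definable_cong) (auto dest: is_setI)
qed

lemma definable_is_set [dfn]:
  assumes "dterm n a" shows "definable n (\<lambda>xs. is_set (a xs))"
proof -
  have "definable n (\<lambda>xs. \<exists>x. is_set x \<and> a xs = x)"
    using assms by (intro dfn)
  then show ?thesis by (rule definable_cong) auto
qed

lemma definable_is_subclass [dfn]: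
  assumes "dterm n a" "dterm n b" shows "definable n (\<lambda>xs. is_subclass (a xs) (b xs))"
  unfolding is_subclass_def by (intro dfn assms)

end

section \<open>Sets, pairs and class functions\<close>

context class_structure
begin

definition upair :: "'c \<Rightarrow> 'c \<Rightarrow> 'c" where
  "upair x y = Coll (\<lambda>u. u = x \<or> u = y)"

definition opair :: "'c \<Rightarrow> 'c \<Rightarrow> 'c" where
  "opair x y = upair (upair x x) (upair x y)"

definition Union_class :: "'c \<Rightarrow> 'c" where
  "Union_class a = Coll (\<lambda>x. \<exists>y. y \<epsilon> a \<and> x \<epsilon> y)"

definition Pow_class :: "'c \<Rightarrow> 'c" where
  "Pow_class a = Coll (\<lambda>x. is_subclass x a)"

definition inter :: "'c \<Rightarrow> 'c \<Rightarrow> 'c" where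
  "inter a b = Coll (\<lambda>x. x \<epsilon> a \<and> x \<epsilon> b)"

definition union2 :: "'c \<Rightarrow> 'c \<Rightarrow> 'c" where
  "union2 a b = Coll (\<lambda>x. x \<epsilon> a \<or> x \<epsilon> b)"

definition succ :: "'c \<Rightarrow> 'c" where
  "succ a = Coll (\<lambda>x. x \<epsilon> a \<or> x = a)"

definition empty :: "'c" where
  "empty = Coll (\<lambda>x. False)"

definition img :: "('c \<Rightarrow> 'c) \<Rightarrow> 'c \<Rightarrow> 'c" where
  "img f a = Coll (\<lambda>y. \<exists>x. x \<epsilon> a \<and> y = f x)"

definition cart :: "'c \<Rightarrow> 'c \<Rightarrow> 'c" where
  "cart A B = Coll (\<lambda>p. \<exists>x. x \<epsilon> A \<and> (\<exists>y. y \<epsilon> B \<and> p = opair x y))"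

text \<open>Given by its elements and not by a description operator: as a comprehension term it is
  definable automatically. The same device serves \<open>snd_class\<close> and
  \<open>app\<close>.\<close>

definition fst_class :: "'c \<Rightarrow> 'c" where
  "fst_class p = Coll (\<lambda>u. \<exists>x. is_set x \<and> (\<exists>y. is_set y \<and> p = opair x y \<and> u \<epsilon> x))"

definition snd_class :: "'c \<Rightarrow> 'c" where
  "snd_class p = Coll (\<lambda>u. \<exists>x. is_set x \<and> (\<exists>y. is_set y \<and> p = opair x y \<and> u \<epsilon> y))"

text \<open>For a class function \<open>F\<close> this is its value at \<open>x\<close>; otherwise a union of values.\<close>

definition app :: "'c \<Rightarrow> 'c \<Rightarrow> 'c" where
  "app F x = Coll (\<lambda>u. \<exists>w. is_set w \<and> opair x w \<epsilon> F \<and> u \<epsilon> w)"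

definition lam :: "'c \<Rightarrow> ('c \<Rightarrow> 'c) \<Rightarrow> 'c" where
  "lam A f = Coll (\<lambda>p. \<exists>x. x \<epsilon> A \<and> p = opair x (f x))"

end

context GB
begin

lemma dterm_upair [dfn]: "dterm n t \<Longrightarrow> dterm n u \<Longrightarrow> dterm n (\<lambda>xs. upair (t xs) (u xs))"
  unfolding upair_def by (intro dfn)

lemma dterm_opair [dfn]: "dterm n t \<Longrightarrow> dterm n u \<Longrightarrow> dterm n (\<lambda>xs. opair (t xs) (u xs))"
  unfolding opair_def by (intro dfn)

lemma dterm_Union_class [dfn]: "dterm n t \<Longrightarrow> dterm n (\<lambda>xs. Union_class (t xs))"
  unfolding Union_class_def by (intro dfn)

lemma dterm_Pow_class [dfn]: "dterm n t \<Longrightarrow> dterm n (\<lambda>xs. Pow_class (t xs))"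
  unfolding Pow_class_def by (intro dfn)

lemma dterm_inter [dfn]: "dterm n t \<Longrightarrow> dterm n u \<Longrightarrow> dterm n (\<lambda>xs. inter (t xs) (u xs))"
  unfolding inter_def by (intro dfn)

lemma dterm_union2 [dfn]: "dterm n t \<Longrightarrow> dterm n u \<Longrightarrow> dterm n (\<lambda>xs. union2 (t xs) (u xs))"
  unfolding union2_def by (intro dfn)

lemma dterm_succ [dfn]: "dterm n t \<Longrightarrow> dterm n (\<lambda>xs. succ (t xs))"
  unfolding succ_def by (intro dfn)

lemma dterm_img [dfn]:
  "dterm (Suc n) (\<lambda>xs. f (tl xs) (hd xs)) \<Longrightarrow> dterm n t \<Longrightarrow> dterm n (\<lambda>xs. img (f xs) (t xs))"
  unfolding img_def by (intro dfn dterm_skip)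

lemma dterm_cart [dfn]: "dterm n t \<Longrightarrow> dterm n u \<Longrightarrow> dterm n (\<lambda>xs. cart (t xs) (u xs))"
  unfolding cart_def by (intro dfn)

lemma dterm_fst_class [dfn]: "dterm n t \<Longrightarrow> dterm n (\<lambda>xs. fst_class (t xs))"
  unfolding fst_class_def by (intro dfn)

lemma dterm_snd_class [dfn]: "dterm n t \<Longrightarrow> dterm n (\<lambda>xs. snd_class (t xs))"
  unfolding snd_class_def by (intro dfn)

lemma dterm_app [dfn]: "dterm n t \<Longrightarrow> dterm n u \<Longrightarrow> dterm n (\<lambda>xs. app (t xs) (u xs))"
  unfolding app_def by (intro dfn)

lemma mem_upair: "u \<epsilon> upair x y \<longleftrightarrow> is_set u \<and> (u = x \<or> u = y)"
  unfolding upair_def by (intro mem_Coll dfn)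

lemma mem_Union_class [simp]: "x \<epsilon> Union_class a \<longleftrightarrow> (\<exists>y. y \<epsilon> a \<and> x \<epsilon> y)"
  unfolding Union_class_def by (subst mem_Coll, intro dfn) (auto dest: is_setI)

lemma mem_Pow_class: "x \<epsilon> Pow_class a \<longleftrightarrow> is_set x \<and> is_subclass x a"
  unfolding Pow_class_def by (intro mem_Coll dfn)

lemma mem_inter [simp]: "x \<epsilon> inter a b \<longleftrightarrow> x \<epsilon> a \<and> x \<epsilon> b"
  unfolding inter_def by (subst mem_Coll, intro dfn) (auto dest: is_setI)

lemma mem_union2 [simp]: "x \<epsilon> union2 a b \<longleftrightarrow> x \<epsilon> a \<or> x \<epsilon> b"
  unfolding union2_def by (subst mem_Coll, intro dfn) (auto dest: is_setI)

lemma mem_succ: "x \<epsilon> succ a \<longleftrightarrow> x \<epsilon> a \<or> is_set x \<and> x = a"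
  unfolding succ_def by (subst mem_Coll, intro dfn) (auto dest: is_setI)

lemma mem_empty [simp]: "\<not> x \<epsilon> empty"
  unfolding empty_def by (subst mem_Coll, intro dfn) auto

lemma mem_img:
  assumes "dterm (Suc 0) (\<lambda>xs. f (hd xs))"
  shows "y \<epsilon> img f a \<longleftrightarrow> is_set y \<and> (\<exists>x. x \<epsilon> a \<and> y = f x)"
  unfolding img_def by (subst mem_Coll, intro dfn dterm_unary[OF assms]) (auto dest: is_setI)

lemma set_upair [intro]:
  assumes "is_set x" "is_set y" shows "is_set (upair x y)"
proof -
  obtain z where "is_set z" "is_upair z x y" using pairing[OF assms] by blast
  moreover from this have "z = upair x y"
    by (intro eqI) (auto simp: is_upair_def mem_upair)
  ultimately show ?thesis by simp
qed

lemma set_opair [intro, simp]: "is_set x \<Longrightarrow> is_set y \<Longrightarrow> is_set (opair x y)"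
  unfolding opair_def by blast

lemma set_Union_class [intro]:
  assumes "is_set a" shows "is_set (Union_class a)"
proof -
  obtain u where u: "is_set u" "\<And>x. x \<epsilon> u \<longleftrightarrow> (\<exists>y. x \<epsilon> y \<and> y \<epsilon> a)"
    using union[OF assms] by blast
  then have "u = Union_class a" by (intro eqI) auto
  with u show ?thesis by simp
qed

lemma set_Pow_class [intro]:
  assumes "is_set a" shows "is_set (Pow_class a)"
proof -
  obtain u where u: "is_set u" "\<And>x. x \<epsilon> u \<longleftrightarrow> is_set x \<and> is_subclass x a"
    using power_set[OF assms] by blast
  then have "u = Pow_class a" by (intro eqI) (auto simp: mem_Pow_class)
  with u show ?thesis by simp
qed

lemma upair_eq_iff:
  assumes "is_set x" "is_set y" "is_set u" "is_set v"
  shows "upair x y = upair u v \<longleftrightarrow> (x = u \<and> y = v) \<or> (x = v \<and> y = u)"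
proof
  assume "upair x y = upair u v"
  then have "w \<epsilon> upair x y \<longleftrightarrow> w \<epsilon> upair u v" for w by simp
  then have "is_set w \<Longrightarrow> w = x \<or> w = y \<longleftrightarrow> w = u \<or> w = v" for w
    unfolding mem_upair by blast
  from this[OF assms(1)] this[OF assms(2)] this[OF assms(3)] this[OF assms(4)]
  show "(x = u \<and> y = v) \<or> (x = v \<and> y = u)" by auto
qed (auto simp: upair_def disj_commute)

lemma opair_eq_iff [simp]:
  assumes "is_set x" "is_set y" "is_set u" "is_set v"
  shows "opair x y = opair u v \<longleftrightarrow> x = u \<and> y = v"
  unfolding opair_def using assms by (auto simp: upair_eq_iff set_upair)

lemma is_upair_iff: "is_upair z x y \<longleftrightarrow> is_set x \<and> is_set y \<and> z = upair x y"
proof -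
  have "(\<forall>u. u \<epsilon> z \<longleftrightarrow> u = x \<or> u = y) \<longleftrightarrow> z = upair x y" if "is_set x" "is_set y"
  proof
    assume "\<forall>u. u \<epsilon> z \<longleftrightarrow> u = x \<or> u = y"
    then show "z = upair x y" by (intro eqI) (auto simp: mem_upair)
  qed (use that in \<open>auto simp: mem_upair\<close>)
  then show ?thesis unfolding is_upair_def by auto
qed

lemma is_opair_iff: "is_opair p x y \<longleftrightarrow> is_set x \<and> is_set y \<and> p = opair x y"
  unfolding is_opair_def is_upair_iff opair_def by auto

lemma pair_in_iff: "pair_in R x y \<longleftrightarrow> is_set x \<and> is_set y \<and> opair x y \<epsilon> R"
  unfolding pair_in_def is_opair_iff by auto

lemma fst_class_opair [simp]:
  assumes "is_set x" "is_set y" shows "fst_class (opair x y) = x"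
proof -
  have "u \<epsilon> fst_class (opair x y) \<longleftrightarrow> u \<epsilon> x" for u
    unfolding fst_class_def by (subst mem_Coll, intro dfn) (use assms in \<open>auto dest: is_setI\<close>)
  then show ?thesis by (intro eqI)
qed

lemma snd_class_opair [simp]:
  assumes "is_set x" "is_set y" shows "snd_class (opair x y) = y"
proof -
  have "u \<epsilon> snd_class (opair x y) \<longleftrightarrow> u \<epsilon> y" for u
    unfolding snd_class_def by (subst mem_Coll, intro dfn) (use assms in \<open>auto dest: is_setI\<close>)
  then show ?thesis by (intro eqI)
qed

lemma app_eq:
  assumes "is_set x" "is_set y" "opair x y \<epsilon> F" "\<And>w. is_set w \<Longrightarrow> opair x w \<epsilon> F \<Longrightarrow> w = y"
  shows "app F x = y"
proof -
  have "u \<epsilon> app F x \<longleftrightarrow> u \<epsilon> y" for u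
    unfolding app_def by (subst mem_Coll, intro dfn) (use assms in \<open>metis is_setI\<close>)
  then show ?thesis by (intro eqI)
qed

text \<open>Replacement for the class of pairs of \<open>x\<close> and \<open>f x\<close>; arguments
  whose value is a proper class drop out on both sides.\<close>

lemma set_img [intro]:
  assumes f: "dterm (Suc 0) (\<lambda>xs. f (hd xs))" and a: "is_set a"
  shows "is_set (img f a)"
proof -
  define F where "F = Coll (\<lambda>p. \<exists>x. is_set x \<and> (\<exists>y. is_set y \<and> p = opair x y \<and> y = f x))"
  have "p \<epsilon> F \<longleftrightarrow> is_set p \<and> (\<exists>x. is_set x \<and> (\<exists>y. is_set y \<and> p = opair x y \<and> y = f x))" for p
    unfolding F_def by (intro mem_Coll dfn dterm_unary[OF f])
  then have F: "pair_in F x y \<longleftrightarrow> is_set x \<and> is_set y \<and> y = f x" for x y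
    unfolding pair_in_iff by auto
  obtain u where u: "is_set u" "\<And>y. y \<epsilon> u \<longleftrightarrow> (\<exists>x. x \<epsilon> a \<and> pair_in F x y)"
    using replacement[OF a, of F] unfolding F by blast
  have "u = img f a"
    by (intro eqI) (auto simp: mem_img[OF f] u F dest: is_setI)
  with u show ?thesis by simp
qed

text \<open>Separation, as replacement along the identity relation on \<open>X\<close>.\<close>

lemma set_sub:
  assumes a: "is_set a" and X: "\<And>x. x \<epsilon> X \<Longrightarrow> x \<epsilon> a"
  shows "is_set X"
proof -
  define F where "F = Coll (\<lambda>p. \<exists>x. x \<epsilon> X \<and> p = opair x x)"
  have *: "p \<epsilon> F \<longleftrightarrow> is_set p \<and> (\<exists>x. x \<epsilon> X \<and> p = opair x x)" for p
    unfolding F_def by (intro mem_Coll dfn)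
  then have F: "pair_in F x y \<longleftrightarrow> x \<epsilon> X \<and> y = x" for x y
    unfolding pair_in_iff * by (metis is_setI opair_eq_iff set_opair)
  obtain u where u: "is_set u" "\<And>y. y \<epsilon> u \<longleftrightarrow> (\<exists>x. x \<epsilon> a \<and> pair_in F x y)"
    using replacement[OF a, of F] unfolding F by blast
  have "u = X"
    by (intro eqI) (auto simp: u F X)
  with u show ?thesis by simp
qed

lemma set_inter1 [intro]: "is_set a \<Longrightarrow> is_set (inter a b)"
  by (rule set_sub[of a]) auto

lemma set_union2 [intro]:
  assumes "is_set a" "is_set b" shows "is_set (union2 a b)"
proof -
  have "union2 a b = Union_class (upair a b)" using assms by (intro eqI) (auto simp: mem_upair)
  then show ?thesis using assms by auto
qed

lemma set_succ [intro]:
  assumes "is_set a" shows "is_set (succ a)"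
proof -
  have "succ a = union2 a (upair a a)" using assms by (intro eqI) (auto simp: mem_succ mem_upair)
  then show ?thesis using assms by auto
qed

lemma set_empty [intro, simp]: "is_set empty"
proof -
  obtain w where "is_set w" using infinity by blast
  then show ?thesis by (rule set_sub) simp
qed

lemma mem_cart: "p \<epsilon> cart A B \<longleftrightarrow> (\<exists>x y. x \<epsilon> A \<and> y \<epsilon> B \<and> p = opair x y)"
  unfolding cart_def by (subst mem_Coll, intro dfn) (auto dest: is_setI)

lemma set_cart [intro]:
  assumes "is_set a" "is_set b" shows "is_set (cart a b)"
proof (rule set_sub)
  show "is_set (Pow_class (Pow_class (union2 a b)))" using assms by blast
  show "p \<epsilon> Pow_class (Pow_class (union2 a b))" if "p \<epsilon> cart a b" for p
    using that unfolding mem_cart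
    by (auto simp: mem_Pow_class is_subclass_def opair_def mem_upair dest: is_setI intro!: set_upair)
qed

text \<open>Foundation for the class of counterexamples; definability of \<open>P\<close> is what
  makes it a class.\<close>

lemma eps_induct:
  assumes "definable (Suc 0) (\<lambda>xs. P (hd xs))"
    and step: "\<And>x. is_set x \<Longrightarrow> (\<And>y. y \<epsilon> x \<Longrightarrow> P y) \<Longrightarrow> P x"
    and "is_set x"
  shows "P x"
proof (rule ccontr)
  assume "\<not> P x"
  have X: "x \<epsilon> Coll (\<lambda>x. \<not> P x) \<longleftrightarrow> is_set x \<and> \<not> P x" for x
    using assms(1) by (intro mem_Coll dfn)
  obtain m where "m \<epsilon> Coll (\<lambda>x. \<not> P x)" "\<And>y. y \<epsilon> m \<Longrightarrow> \<not> y \<epsilon> Coll (\<lambda>x. \<not> P x)"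
    using foundation[of x "Coll (\<lambda>x. \<not> P x)"] X assms(3) \<open>\<not> P x\<close> by blast
  then show False using step[of m] unfolding X by (auto dest: is_setI)
qed

lemma mem_irrefl: "\<not> x \<epsilon> x"
proof
  assume x: "x \<epsilon> x"
  then have "x \<epsilon> upair x x" by (auto simp: mem_upair dest: is_setI)
  from foundation[OF this] show False using x by (auto simp: mem_upair dest: is_setI)
qed

lemma mem_asym: "x \<epsilon> y \<Longrightarrow> \<not> y \<epsilon> x"
proof
  assume xy: "x \<epsilon> y" "y \<epsilon> x"
  then have "x \<epsilon> upair x y" by (auto simp: mem_upair dest: is_setI)
  from foundation[OF this] show False using xy by (auto simp: mem_upair dest: is_setI)
qed

lemma mem_asym3: "x \<epsilon> y \<Longrightarrow> y \<epsilon> z \<Longrightarrow> \<not> z \<epsilon> x"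
proof
  assume xy: "x \<epsilon> y" "y \<epsilon> z" "z \<epsilon> x"
  then have "z \<epsilon> union2 (upair x x) (upair y z)"
    by (auto simp: mem_upair dest: is_setI)
  from foundation[OF this] show False using xy by (auto simp: mem_upair dest: is_setI)
qed

end

section \<open>Recursion on membership\<close>

context class_structure
begin

notation is_subclass (infix "\<sqsubseteq>" 50)

definition rel_image :: "'c \<Rightarrow> 'c \<Rightarrow> 'c" where
  "rel_image f x = Coll (\<lambda>w. \<exists>z. z \<epsilon> x \<and> opair z w \<epsilon> f)"

text \<open>Set-sized approximations of the function \<open>F x = H {F y | y \<epsilon> x}\<close>.\<close>

definition approx :: "('c \<Rightarrow> 'c) \<Rightarrow> 'c \<Rightarrow> bool" where
  "approx H f \<longleftrightarrow> is_set f \<and>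
     (\<forall>x. is_set x \<longrightarrow> (\<forall>y. is_set y \<longrightarrow> opair x y \<epsilon> f \<longrightarrow>
        (\<forall>z. z \<epsilon> x \<longrightarrow> (\<exists>w. is_set w \<and> opair z w \<epsilon> f)) \<and> y = H (rel_image f x)))"

definition approx_union :: "('c \<Rightarrow> 'c) \<Rightarrow> 'c" where
  "approx_union H = Coll (\<lambda>p. \<exists>f. is_set f \<and> approx H f \<and> p \<epsilon> f)"

text \<open>The intersection of all approximations defined at \<open>z\<close>. Being canonical, it
  can be collected over the elements of a set by replacement, without choosing
  approximations.\<close>

definition least_approx :: "('c \<Rightarrow> 'c) \<Rightarrow> 'c \<Rightarrow> 'c" where
  "least_approx H z = Coll (\<lambda>p. \<forall>f. is_set f \<longrightarrow> approx H f \<and> (\<exists>y. is_set y \<and> opair z y \<epsilon> f) \<longrightarrow> p \<epsilon> f)"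

text \<open>Picked once in the metatheory; as a fixed class it then serves as a parameter of
  formulas. Existence comes from \<open>recursion\<close>.\<close>

definition V_graph :: "'c" where
  "V_graph = (SOME F. \<forall>x. is_set x \<longrightarrow>
     is_set (app F x) \<and> app F x = Union_class (img Pow_class (img (app F) x)))"

text \<open>The level of the cumulative hierarchy at the rank of \<open>x\<close>. With sets as
  indices, \<open>y \<epsilon> V x\<close> expresses that \<open>y\<close> has smaller rank than
  \<open>x\<close>.\<close>

definition V :: "'c \<Rightarrow> 'c" where
  "V x = app V_graph x"

lemma subI: "(\<And>x. x \<epsilon> a \<Longrightarrow> x \<epsilon> b) \<Longrightarrow> a \<sqsubseteq> b"
  and subD: "a \<sqsubseteq> b \<Longrightarrow> x \<epsilon> a \<Longrightarrow> x \<epsilon> b"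
  by (auto simp: is_subclass_def)

end

context GB
begin

lemma dterm_rel_image [dfn]: "dterm n t \<Longrightarrow> dterm n u \<Longrightarrow> dterm n (\<lambda>xs. rel_image (t xs) (u xs))"
  unfolding rel_image_def by (intro dfn)

lemma mem_rel_image: "w \<epsilon> rel_image f x \<longleftrightarrow> is_set w \<and> (\<exists>z. z \<epsilon> x \<and> opair z w \<epsilon> f)"
  unfolding rel_image_def by (intro mem_Coll dfn)

lemma mem_lam:
  assumes "dterm (Suc 0) (\<lambda>xs. f (hd xs))"
  shows "p \<epsilon> lam A f \<longleftrightarrow> is_set p \<and> (\<exists>x. x \<epsilon> A \<and> p = opair x (f x))"
  unfolding lam_def by (intro mem_Coll dfn dterm_unary[OF assms])

lemma set_lam:
  assumes "dterm (Suc 0) (\<lambda>xs. f (hd xs))" "is_set A"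
  shows "is_set (lam A f)"
proof -
  have d: "dterm (Suc 0) (\<lambda>xs. opair (hd xs) (f (hd xs)))"
    by (intro dfn assms)
  have "lam A f = img (\<lambda>x. opair x (f x)) A"
    by (intro eqI) (simp add: mem_lam assms mem_img[OF d])
  then show ?thesis using set_img[OF d assms(2)] by simp
qed

lemma opair_lam:
  assumes "dterm (Suc 0) (\<lambda>xs. f (hd xs))" "\<And>x. x \<epsilon> A \<Longrightarrow> is_set (f x)" "is_set x" "is_set y"
  shows "opair x y \<epsilon> lam A f \<longleftrightarrow> x \<epsilon> A \<and> y = f x"
  unfolding mem_lam[OF assms(1)] using assms(2-) by (metis is_setI opair_eq_iff set_opair)

lemma app_lam:
  assumes "dterm (Suc 0) (\<lambda>xs. f (hd xs))" "\<And>x. x \<epsilon> A \<Longrightarrow> is_set (f x)" "x \<epsilon> A"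
  shows "app (lam A f) x = f x"
proof -
  have "is_set x" using is_setI[OF assms(3)] .
  then show ?thesis
    using assms opair_lam[OF assms(1,2)] by (intro app_eq) blast+
qed

section \<open>The recursion theorem for a definable operation \<open>H\<close>\<close>

context
  fixes H :: "'c \<Rightarrow> 'c"
  assumes H: "\<And>n t. dterm n t \<Longrightarrow> dterm n (\<lambda>xs. H (t xs))"
    and H_set: "\<And>z. is_set z \<Longrightarrow> is_set (H z)"
begin

lemma definable_approx: "dterm n t \<Longrightarrow> definable n (\<lambda>xs. approx H (t xs))"
  unfolding approx_def by (intro dfn H)

lemma dterm_least_approx: "dterm n t \<Longrightarrow> dterm n (\<lambda>xs. least_approx H (t xs))"
  unfolding least_approx_def by (intro dfn definable_approx)

lemma mem_approx_union: "p \<epsilon> approx_union H \<longleftrightarrow> (\<exists>f. approx H f \<and> p \<epsilon> f)"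
proof -
  have "p \<epsilon> approx_union H \<longleftrightarrow> is_set p \<and> (\<exists>f. is_set f \<and> approx H f \<and> p \<epsilon> f)"
    unfolding approx_union_def by (intro mem_Coll dfn definable_approx)
  then show ?thesis by (auto simp: approx_def dest: is_setI)
qed

lemma mem_least_approx:
  "p \<epsilon> least_approx H z \<longleftrightarrow>
     is_set p \<and> (\<forall>f. is_set f \<longrightarrow> approx H f \<and> (\<exists>y. is_set y \<and> opair z y \<epsilon> f) \<longrightarrow> p \<epsilon> f)"
  unfolding least_approx_def by (intro mem_Coll dfn definable_approx)

lemma approxD:
  assumes "approx H f" "opair x y \<epsilon> f" "is_set x" "is_set y"
  shows "z \<epsilon> x \<Longrightarrow> \<exists>w. is_set w \<and> opair z w \<epsilon> f" and "y = H (rel_image f x)"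
  using assms unfolding approx_def by blast+

text \<open>Two approximations that agree below \<open>x\<close> have the same
  \<open>rel_image\<close> there, hence the same value at \<open>x\<close>. All quantifiers range
  over sets to keep the statement definable for the induction.\<close>

lemma approx_unique:
  assumes "is_set x"
  shows "\<forall>f. is_set f \<longrightarrow> (\<forall>g. is_set g \<longrightarrow> (\<forall>y. is_set y \<longrightarrow> (\<forall>y'. is_set y' \<longrightarrow>
           approx H f \<longrightarrow> approx H g \<longrightarrow> opair x y \<epsilon> f \<longrightarrow> opair x y' \<epsilon> g \<longrightarrow> y = y')))"
  (is "?P x")
proof (rule eps_induct[where P = ?P, OF _ _ assms])
  show "definable (Suc 0) (\<lambda>xs. ?P (hd xs))" by (intro dfn definable_approx)
next
  fix x assume x: "is_set x" and IH: "\<And>z. z \<epsilon> x \<Longrightarrow> ?P z"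
  show "?P x"
  proof (intro allI impI)
    fix f g y y' assume a: "is_set f" "is_set g" "is_set y" "is_set y'" "approx H f" "approx H g"
      "opair x y \<epsilon> f" "opair x y' \<epsilon> g"
    have "w \<epsilon> rel_image f x \<longleftrightarrow> w \<epsilon> rel_image g x" for w
      unfolding mem_rel_image using approxD(1)[OF a(5,7) x a(3)] approxD(1)[OF a(6,8) x a(4)] IH a by metis
    then have "rel_image f x = rel_image g x" by (intro eqI)
    then show "y = y'" using approxD(2)[OF a(5,7) x a(3)] approxD(2)[OF a(6,8) x a(4)] by simp
  qed
qed

lemma approx_union_unique:
  assumes "opair x y \<epsilon> approx_union H" "opair x y' \<epsilon> approx_union H" "is_set x" "is_set y" "is_set y'"
  shows "y = y'"
proof -
  obtain f g where "approx H f" "approx H g" "opair x y \<epsilon> f" "opair x y' \<epsilon> g"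
    using assms unfolding mem_approx_union by blast
  then show ?thesis using approx_unique[OF assms(3)] assms by (auto simp: approx_def)
qed

lemma rel_image_approx_union:
  assumes "\<And>t w. is_set t \<Longrightarrow> is_set w \<Longrightarrow> opair t w \<epsilon> g \<Longrightarrow> opair t w \<epsilon> approx_union H"
    and "\<And>t. t \<epsilon> u \<Longrightarrow> \<exists>w. is_set w \<and> opair t w \<epsilon> g"
  shows "rel_image g u = rel_image (approx_union H) u"
proof (intro eqI)
  fix w assume "is_set w"
  then show "w \<epsilon> rel_image g u \<longleftrightarrow> w \<epsilon> rel_image (approx_union H) u"
    unfolding mem_rel_image using assms approx_union_unique is_setI by metis
qed

lemma approx_union_rec:
  assumes "opair x y \<epsilon> approx_union H" "is_set x" "is_set y"
  shows "z \<epsilon> x \<Longrightarrow> \<exists>w. is_set w \<and> opair z w \<epsilon> approx_union H" and "y = H (rel_image (approx_union H) x)"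
proof -
  obtain f where f: "approx H f" "opair x y \<epsilon> f" using assms mem_approx_union by blast
  show "\<exists>w. is_set w \<and> opair z w \<epsilon> approx_union H" if "z \<epsilon> x"
    using approxD(1)[OF f assms(2,3) that] f mem_approx_union by blast
  have "rel_image f x = rel_image (approx_union H) x"
    using f approxD(1)[OF f assms(2,3)] mem_approx_union by (intro rel_image_approx_union) blast+
  then show "y = H (rel_image (approx_union H) x)" using approxD(2)[OF f assms(2,3)] by simp
qed

text \<open>Values inside \<open>approx_union\<close> are unique, so a part of it whose domain is
  closed under elements has the same images and inherits the recursion equation.\<close>

lemma approxI:
  assumes "is_set g"
    and "\<And>t w. is_set t \<Longrightarrow> is_set w \<Longrightarrow> opair t w \<epsilon> g \<Longrightarrow> opair t w \<epsilon> approx_union H"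
    and "\<And>u v t. is_set u \<Longrightarrow> is_set v \<Longrightarrow> opair u v \<epsilon> g \<Longrightarrow> t \<epsilon> u \<Longrightarrow> \<exists>w. is_set w \<and> opair t w \<epsilon> g"
  shows "approx H g"
  unfolding approx_def
proof (intro conjI allI impI)
  fix u v assume uv: "is_set u" "is_set v" "opair u v \<epsilon> g"
  show "\<exists>w. is_set w \<and> opair t w \<epsilon> g" if "t \<epsilon> u" for t
    using assms(3)[OF uv that] .
  have "rel_image g u = rel_image (approx_union H) u"
    using assms(2) assms(3)[OF uv] by (intro rel_image_approx_union)
  then show "v = H (rel_image g u)" using approx_union_rec(2)[OF assms(2)[OF uv] uv(1,2)] by simp
qed (rule assms)

text \<open>The domain of the intersection stays closed under elements, because any two
  approximations take the same value wherever both are defined.\<close>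

lemma least_approx:
  assumes "opair z y \<epsilon> approx_union H" "is_set z" "is_set y"
  shows "approx H (least_approx H z)" "opair z y \<epsilon> least_approx H z"
proof -
  obtain f where f: "approx H f" "opair z y \<epsilon> f" using assms mem_approx_union by blast
  have sub: "p \<epsilon> f" if "p \<epsilon> least_approx H z" for p
    using that f assms unfolding mem_least_approx by (metis approx_def)
  show 2: "opair z y \<epsilon> least_approx H z"
    unfolding mem_least_approx using f assms approx_unique[OF assms(2)] by (metis approx_def set_opair)
  show "approx H (least_approx H z)"
  proof (rule approxI)
    show "is_set (least_approx H z)" using f sub by (metis approx_def set_sub)
    show "opair t w \<epsilon> approx_union H" if "opair t w \<epsilon> least_approx H z" for t w
      using sub[OF that] f mem_approx_union by blast
    fix u v t assume uv: "is_set u" "is_set v" "opair u v \<epsilon> least_approx H z" "t \<epsilon> u"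
    obtain w where w: "is_set w" "opair t w \<epsilon> f"
      using approxD(1)[OF f(1) sub[OF uv(3)] uv(1,2,4)] by blast
    have "opair t w \<epsilon> g" if g: "is_set g" "approx H g" "is_set y'" "opair z y' \<epsilon> g" for g y'
    proof -
      have "opair u v \<epsilon> g" using uv(3) g unfolding mem_least_approx by blast
      then obtain w' where "is_set w'" "opair t w' \<epsilon> g"
        using approxD(1)[OF g(2) _ uv(1,2,4)] by blast
      then show ?thesis
        using approx_union_unique[of t w w'] w f g uv mem_approx_union is_setI by metis
    qed
    then show "\<exists>w. is_set w \<and> opair t w \<epsilon> least_approx H z"
      unfolding mem_least_approx using w uv(4) is_setI by (metis set_opair)
  qed
qed

text \<open>By induction, the least approximations at the elements of \<open>x\<close> glue to
  \<open>g0\<close>; adding the pair \<open>p\<close> gives an approximation defined at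
  \<open>x\<close>.\<close>

lemma approx_union_total:
  assumes "is_set x" shows "\<exists>y. is_set y \<and> opair x y \<epsilon> approx_union H" (is "?P x")
proof (rule eps_induct[where P = ?P, OF _ _ assms])
  show "definable (Suc 0) (\<lambda>xs. ?P (hd xs))" by (intro dfn)
next
  fix x assume x: "is_set x" and IH: "\<And>z. z \<epsilon> x \<Longrightarrow> ?P z"
  show "?P x"
  proof (rule ccontr)
    assume nx: "\<not> ?P x"
    define g0 where "g0 = Union_class (img (least_approx H) x)"
    have d: "dterm (Suc 0) (\<lambda>xs. least_approx H (hd xs))" by (intro dfn dterm_least_approx)
    have la: "approx H (least_approx H z)" if "z \<epsilon> x" for z
      using IH[OF that] least_approx(1) is_setI[OF that] by blast
    then have las: "is_set (least_approx H z)" if "z \<epsilon> x" for z using that unfolding approx_def by blast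
    have g0: "p \<epsilon> g0 \<longleftrightarrow> (\<exists>z. z \<epsilon> x \<and> p \<epsilon> least_approx H z)" for p
      unfolding g0_def using las by (auto simp: mem_img[OF d])
    have g0F: "p \<epsilon> approx_union H" if "p \<epsilon> g0" for p
      using that la unfolding g0 mem_approx_union by blast
    have "approx H g0"
    proof (rule approxI)
      show "is_set g0" unfolding g0_def using set_img[OF d x] by blast
      show "opair t w \<epsilon> approx_union H" if "opair t w \<epsilon> g0" for t w using g0F that .
      show "\<exists>w. is_set w \<and> opair t w \<epsilon> g0"
        if "is_set u" "is_set v" "opair u v \<epsilon> g0" "t \<epsilon> u" for u v t
      proof -
        obtain z where z: "z \<epsilon> x" "opair u v \<epsilon> least_approx H z" using \<open>opair u v \<epsilon> g0\<close> g0 by blast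
        show ?thesis using approxD(1)[OF la[OF z(1)] z(2) that(1,2,4)] z(1) g0 by blast
      qed
    qed
    have dom0: "\<exists>w. is_set w \<and> opair z w \<epsilon> g0" if "z \<epsilon> x" for z
      using IH[OF that] least_approx(2) is_setI[OF that] that unfolding g0 by blast
    have Im0: "rel_image g0 x = rel_image (approx_union H) x" using g0F dom0 by (intro rel_image_approx_union)
    have "is_set (rel_image g0 x)"
    proof -
      have "w \<epsilon> Union_class (Union_class g0)" if "w \<epsilon> rel_image g0 x" for w
      proof -
        from that obtain z where z: "z \<epsilon> x" "opair z w \<epsilon> g0" "is_set w" unfolding mem_rel_image by blast
        moreover have "upair z w \<epsilon> opair z w" "w \<epsilon> upair z w"
          using z is_setI unfolding opair_def mem_upair by blast+
        ultimately show ?thesis unfolding mem_Union_class by blast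
      qed
      moreover have "is_set (Union_class (Union_class g0))" using \<open>approx H g0\<close> unfolding approx_def by blast
      ultimately show ?thesis using set_sub by blast
    qed
    then have y: "is_set (H (rel_image g0 x))" by (rule H_set)
    define p where "p = opair x (H (rel_image g0 x))"
    have p: "is_set p" unfolding p_def using x y by blast
    define g where "g = union2 g0 (upair p p)"
    have g: "q \<epsilon> g \<longleftrightarrow> q \<epsilon> g0 \<or> q = p" for q
      unfolding g_def using p by (auto simp: mem_upair)
    have gx: "opair u v \<epsilon> g \<longleftrightarrow> opair u v \<epsilon> g0 \<or> u = x \<and> v = H (rel_image g0 x)"
      if "is_set u" "is_set v" for u v
      unfolding g p_def using that x y by simp
    \<comment> \<open>Adding \<open>p\<close> affects only the value at \<open>x\<close>, so images
      of sets not containing \<open>x\<close> are unchanged.\<close>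
    have Img: "rel_image g u = rel_image g0 u" if "\<not> x \<epsilon> u" for u
      using that gx is_setI by (intro eqI) (metis mem_rel_image)
    have "approx H g"
      unfolding approx_def
    proof (intro conjI allI impI)
      show "is_set g" unfolding g_def using p \<open>approx H g0\<close> unfolding approx_def by blast
      fix u v assume uv: "is_set u" "is_set v" "opair u v \<epsilon> g"
      have "(\<forall>t. t \<epsilon> u \<longrightarrow> (\<exists>w. is_set w \<and> opair t w \<epsilon> g0)) \<and> v = H (rel_image g u)"
      proof (cases "opair u v \<epsilon> g0")
        case True
        have *: "\<exists>w. is_set w \<and> opair t w \<epsilon> g0" if "t \<epsilon> u" for t
          using approxD(1)[OF \<open>approx H g0\<close> True uv(1,2) that] .
        \<comment> \<open>All elements of \<open>u\<close> have values, whereas \<open>x\<close> is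
          assumed to have none.\<close>
        then have "\<not> x \<epsilon> u" using nx g0F by blast
        then show ?thesis using * Img approxD(2)[OF \<open>approx H g0\<close> True uv(1,2)] by simp
      next
        case False
        then have "u = x" "v = H (rel_image g0 x)" using gx uv by auto
        then show ?thesis using dom0 Img[OF mem_irrefl] by simp
      qed
      then show "v = H (rel_image g u)" "\<And>t. t \<epsilon> u \<Longrightarrow> \<exists>w. is_set w \<and> opair t w \<epsilon> g"
        unfolding g by blast+
    qed
    then show False using nx g x y mem_approx_union p_def by blast
  qed
qed

theorem recursion:
  "\<exists>F. \<forall>x. is_set x \<longrightarrow> is_set (app F x) \<and> app F x = H (img (app F) x)"
proof (intro exI allI impI)
  fix x assume x: "is_set x"
  have val: "app (approx_union H) z = w" if "opair z w \<epsilon> approx_union H" "is_set z" "is_set w" for z w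
    using that approx_union_unique by (intro app_eq) blast+
  have d: "dterm (Suc 0) (\<lambda>xs. app (approx_union H) (hd xs))" by (intro dfn)
  have "rel_image (approx_union H) x = img (app (approx_union H)) x"
  proof (intro eqI)
    fix w assume "is_set w"
    then show "w \<epsilon> rel_image (approx_union H) x \<longleftrightarrow> w \<epsilon> img (app (approx_union H)) x"
      unfolding mem_rel_image mem_img[OF d] using val approx_union_total is_setI by metis
  qed
  moreover obtain y where y: "is_set y" "opair x y \<epsilon> approx_union H" using approx_union_total[OF x] by blast
  ultimately show "is_set (app (approx_union H) x) \<and> app (approx_union H) x = H (img (app (approx_union H)) x)"
    using val[OF y(2) x y(1)] approx_union_rec(2)[OF y(2) x y(1)] by simp
qed

end

end

section \<open>The cumulative hierarchy and ordinals\<close>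

context class_structure
begin

definition rank :: "'c \<Rightarrow> 'c" where
  "rank x = Coll (\<lambda>y. y \<epsilon> V x \<and> is_ord y)"

end

context GB
begin

lemma dterm_V [dfn]: "dterm n t \<Longrightarrow> dterm n (\<lambda>xs. V (t xs))"
  unfolding V_def by (intro dfn)

lemma V_rec:
  assumes "is_set x" shows "is_set (V x)" "V x = Union_class (img Pow_class (img V x))"
proof -
  have "\<exists>F. \<forall>x. is_set x \<longrightarrow> is_set (app F x) \<and> app F x = Union_class (img Pow_class (img (app F) x))"
    by (rule recursion[of "\<lambda>z. Union_class (img Pow_class z)"]) (intro dfn, assumption, intro set_Union_class set_img dfn)
  from someI_ex[OF this, folded V_graph_def] show "is_set (V x)" "V x = Union_class (img Pow_class (img V x))"
    using assms unfolding V_def by blast+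
qed

lemma mem_V:
  assumes "is_set x" shows "z \<epsilon> V x \<longleftrightarrow> is_set z \<and> (\<exists>y. y \<epsilon> x \<and> z \<sqsubseteq> V y)"
proof -
  have 1: "dterm (Suc 0) (\<lambda>xs. Pow_class (hd xs))" "dterm (Suc 0) (\<lambda>xs. V (hd xs))" by (intro dfn)+
  show ?thesis
    unfolding V_rec(2)[OF assms] using is_setI V_rec(1) set_Pow_class by (simp add: mem_img[OF 1(1)] mem_img[OF 1(2)]) (metis mem_Pow_class)
qed

lemma VI: "y \<epsilon> x \<Longrightarrow> is_set x \<Longrightarrow> is_set z \<Longrightarrow> z \<sqsubseteq> V y \<Longrightarrow> z \<epsilon> V x"
  by (auto simp: mem_V)

lemma VE:
  assumes "z \<epsilon> V x" "is_set x" obtains y where "y \<epsilon> x" "is_set y" "z \<sqsubseteq> V y" "is_set z"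
  using assms by (auto simp: mem_V dest: is_setI)

lemma V_trans:
  assumes "is_set x" shows "\<forall>z. z \<epsilon> V x \<longrightarrow> z \<sqsubseteq> V x" (is "?P x")
proof (rule eps_induct[where P = ?P, OF _ _ assms])
  show "definable (Suc 0) (\<lambda>xs. ?P (hd xs))" by (intro dfn)
next
  fix x assume x: "is_set x" and IH: "\<And>z. z \<epsilon> x \<Longrightarrow> ?P z"
  show "?P x"
  proof (intro allI impI subI)
    fix z w assume "z \<epsilon> V x" "w \<epsilon> z"
    then obtain y where y: "y \<epsilon> x" "z \<sqsubseteq> V y" using x by (auto elim: VE)
    then have "w \<sqsubseteq> V y" using IH \<open>w \<epsilon> z\<close> by (auto dest: subD)
    then show "w \<epsilon> V x" using VI[OF y(1) x] is_setI[OF \<open>w \<epsilon> z\<close>] by blast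
  qed
qed

lemma V_mem_trans: "y \<epsilon> z \<Longrightarrow> z \<epsilon> V x \<Longrightarrow> is_set x \<Longrightarrow> y \<epsilon> V x"
  using V_trans subD by blast

lemma sub_V:
  assumes "is_set x" shows "x \<sqsubseteq> V x"
proof (rule eps_induct[where P = "\<lambda>x. x \<sqsubseteq> V x", OF _ _ assms])
  show "definable (Suc 0) (\<lambda>xs. hd xs \<sqsubseteq> V (hd xs))" by (intro dfn)
  show "x \<sqsubseteq> V x" if "is_set x" "\<And>y. y \<epsilon> x \<Longrightarrow> y \<sqsubseteq> V y" for x
  proof (rule subI)
    fix y assume "y \<epsilon> x"
    then show "y \<epsilon> V x" using VI[of y x y] that is_setI by blast
  qed
qed

lemma V_sub_closed: "z \<epsilon> V x \<Longrightarrow> w \<sqsubseteq> z \<Longrightarrow> is_set x \<Longrightarrow> w \<epsilon> V x"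
  by (auto simp: mem_V is_subclass_def intro: set_sub[of z])

lemma V_mono_mem:
  assumes "is_set x" shows "\<forall>y. y \<epsilon> V x \<longrightarrow> V y \<epsilon> V x" (is "?P x")
proof (rule eps_induct[where P = ?P, OF _ _ assms])
  show "definable (Suc 0) (\<lambda>xs. ?P (hd xs))" by (intro dfn)
next
  fix x assume x: "is_set x" and IH: "\<And>z. z \<epsilon> x \<Longrightarrow> ?P z"
  show "?P x"
  proof (intro allI impI)
    fix y assume "y \<epsilon> V x"
    then obtain w where w: "w \<epsilon> x" "is_set w" "y \<sqsubseteq> V w" "is_set y" using x by (auto elim: VE)
    have "V y \<sqsubseteq> V w"
    proof (rule subI)
      fix v assume "v \<epsilon> V y"
      then obtain u where u: "u \<epsilon> y" "v \<sqsubseteq> V u" using w by (auto elim: VE)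
      then have "V u \<epsilon> V w" using IH[OF w(1)] w(3) subD by blast
      then show "v \<epsilon> V w" using u w V_sub_closed by blast
    qed
    then show "V y \<epsilon> V x" using VI[OF w(1) x] V_rec(1)[OF w(4)] by blast
  qed
qed

lemma V_sub_mono:
  assumes "y \<sqsubseteq> V x" "is_set x" "is_set y" shows "V y \<sqsubseteq> V x"
proof (rule subI)
  fix v assume "v \<epsilon> V y"
  then obtain u where u: "u \<epsilon> y" "v \<sqsubseteq> V u" using assms by (auto elim: VE)
  then have "V u \<epsilon> V x" using V_mono_mem assms subD by blast
  then show "v \<epsilon> V x" using u assms V_sub_closed by blast
qed

text \<open>Comparability of ranks, stated without ordinals. The induction on \<open>x\<close> needs
  \<open>y\<close> arbitrary, since it descends to an element \<open>u\<close> of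
  \<open>y\<close>.\<close>

lemma V_linear:
  assumes "is_set x" shows "\<forall>y. is_set y \<longrightarrow> \<not> y \<epsilon> V x \<longrightarrow> V x \<sqsubseteq> V y" (is "?P x")
proof (rule eps_induct[where P = ?P, OF _ _ assms])
  show "definable (Suc 0) (\<lambda>xs. ?P (hd xs))" by (intro dfn)
next
  fix x assume x: "is_set x" and IH: "\<And>z. z \<epsilon> x \<Longrightarrow> ?P z"
  show "?P x"
  proof (intro allI impI subI)
    fix y v assume y: "is_set y" "\<not> y \<epsilon> V x" and "v \<epsilon> V x"
    then obtain w where w: "w \<epsilon> x" "is_set w" "v \<sqsubseteq> V w" "is_set v" using x by (auto elim: VE)
    have "\<not> y \<sqsubseteq> V w" using y VI w(1) x by blast
    then obtain u where u: "u \<epsilon> y" "\<not> u \<epsilon> V w" by (auto simp: is_subclass_def)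
    then have "V w \<sqsubseteq> V u" using IH[OF w(1)] is_setI by blast
    then have "v \<sqsubseteq> V u" using w(3) by (auto simp: is_subclass_def)
    then show "v \<epsilon> V y" using VI u(1) y(1) w(4) by blast
  qed
qed

lemma not_mem_V:
  assumes "is_set x" shows "\<not> x \<epsilon> V x"
proof (rule eps_induct[where P = "\<lambda>x. \<not> x \<epsilon> V x", OF _ _ assms])
  show "definable (Suc 0) (\<lambda>xs. \<not> hd xs \<epsilon> V (hd xs))" by (intro dfn)
  show "\<not> x \<epsilon> V x" if x: "is_set x" "\<And>y. y \<epsilon> x \<Longrightarrow> \<not> y \<epsilon> V y" for x
  proof
    assume "x \<epsilon> V x"
    then obtain y where "y \<epsilon> x" "x \<sqsubseteq> V y" using x by (auto elim: VE)
    then show False using x(2) subD by blast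
  qed
qed

text \<open>Induction on rank: membership induction is applied to the statement that all of
  \<open>V x\<close> lies in the class \<open>X\<close> of sets with the property.\<close>

lemma V_induct:
  assumes d: "definable (Suc 0) (\<lambda>xs. P (hd xs))"
    and step: "\<And>x. is_set x \<Longrightarrow> (\<And>z. z \<epsilon> V x \<Longrightarrow> P z) \<Longrightarrow> P x" and x: "is_set x"
  shows "P x"
proof (rule step[OF x])
  define X where "X = Coll P"
  have X: "z \<epsilon> X \<longleftrightarrow> is_set z \<and> P z" for z unfolding X_def using d by (intro mem_Coll)
  have "\<forall>z. z \<epsilon> V x \<longrightarrow> z \<epsilon> X"
  proof (rule eps_induct[where P = "\<lambda>x. \<forall>z. z \<epsilon> V x \<longrightarrow> z \<epsilon> X", OF _ _ x])
    show "definable (Suc 0) (\<lambda>xs. \<forall>z. z \<epsilon> V (hd xs) \<longrightarrow> z \<epsilon> X)" by (intro dfn)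
    show "\<forall>z. z \<epsilon> V x \<longrightarrow> z \<epsilon> X"
      if x: "is_set x" and IH: "\<And>y. y \<epsilon> x \<Longrightarrow> \<forall>z. z \<epsilon> V y \<longrightarrow> z \<epsilon> X" for x
    proof (intro allI impI)
      fix z assume "z \<epsilon> V x"
      then obtain y where y: "y \<epsilon> x" "is_set y" "z \<sqsubseteq> V y" "is_set z" using x by (auto elim: VE)
      then have "V z \<sqsubseteq> V y" using V_sub_mono by blast
      then have "P w" if "w \<epsilon> V z" for w using that IH[OF y(1)] X subD by blast
      then show "z \<epsilon> X" using step[OF y(4)] X y(4) by blast
    qed
  qed
  then show "P z" if "z \<epsilon> V x" for z using that X by blast
qed

text \<open>Foundation supplies irreflexivity, transitivity of membership on \<open>a\<close> and
  least elements. The remaining clauses have bounded quantifiers, which suits the definability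
  rules.\<close>

lemma is_ord_iff:
  "is_ord a \<longleftrightarrow> is_set a \<and> (\<forall>x. x \<epsilon> a \<longrightarrow> x \<sqsubseteq> a) \<and>
     (\<forall>x. x \<epsilon> a \<longrightarrow> (\<forall>y. y \<epsilon> a \<longrightarrow> x \<epsilon> y \<or> x = y \<or> y \<epsilon> x))"
proof
  assume a: "is_set a \<and> (\<forall>x. x \<epsilon> a \<longrightarrow> x \<sqsubseteq> a) \<and>
     (\<forall>x. x \<epsilon> a \<longrightarrow> (\<forall>y. y \<epsilon> a \<longrightarrow> x \<epsilon> y \<or> x = y \<or> y \<epsilon> x))"
  have min: "\<exists>m. m \<epsilon> s \<and> (\<forall>y. y \<epsilon> s \<longrightarrow> m = y \<or> m \<epsilon> y)" if "s \<sqsubseteq> a" "x \<epsilon> s" for s x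
    using foundation[OF that(2)] a that(1) by (metis subD)
  have trans: "x \<epsilon> z" if "x \<epsilon> a" "y \<epsilon> a" "z \<epsilon> a" "x \<epsilon> y" "y \<epsilon> z" for x y z
    using a that mem_asym3 mem_asym by metis
  show "is_ord a"
    unfolding is_ord_def using a mem_irrefl min trans by (intro conjI) blast+
next
  assume "is_ord a"
  then show "is_set a \<and> (\<forall>x. x \<epsilon> a \<longrightarrow> x \<sqsubseteq> a) \<and>
     (\<forall>x. x \<epsilon> a \<longrightarrow> (\<forall>y. y \<epsilon> a \<longrightarrow> x \<epsilon> y \<or> x = y \<or> y \<epsilon> x))"
    unfolding is_ord_def by (intro conjI) (blast | metis)+
qed

lemma definable_is_ord [dfn]: "dterm n t \<Longrightarrow> definable n (\<lambda>xs. is_ord (t xs))"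
  unfolding is_ord_iff by (intro dfn)

lemma ord_set: "is_ord a \<Longrightarrow> is_set a"
  and ord_trans: "is_ord a \<Longrightarrow> x \<epsilon> y \<Longrightarrow> y \<epsilon> a \<Longrightarrow> x \<epsilon> a"
  by (auto simp: is_ord_iff dest: subD)

lemma ord_mem: assumes "is_ord a" "x \<epsilon> a" shows "is_ord x"
proof -
  have "u \<epsilon> x" if "u \<epsilon> v" "v \<epsilon> x" for u v
  proof -
    have "v \<epsilon> a" using ord_trans[OF assms(1) that(2) assms(2)] .
    then have "u \<epsilon> a" using ord_trans[OF assms(1) that(1)] by blast
    then have "u \<epsilon> x \<or> u = x \<or> x \<epsilon> u" using assms unfolding is_ord_iff by blast
    then show ?thesis using mem_asym3[OF that] mem_asym[OF that(1)] that(2) by blast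
  qed
  moreover have "u \<epsilon> a" if "u \<epsilon> x" for u using ord_trans[OF assms(1) that assms(2)] .
  ultimately show ?thesis using assms(1) is_setI[OF assms(2)]
    unfolding is_ord_iff is_subclass_def by blast
qed

text \<open>Nested inductions on \<open>a\<close> and \<open>b\<close>: in a minimal incomparable
  pair the elements of each belong to the other, so the two would be equal.\<close>

lemma ord_linear:
  assumes "is_ord a" "is_ord b" shows "a \<epsilon> b \<or> a = b \<or> b \<epsilon> a"
proof -
  have "\<forall>b. is_set b \<longrightarrow> is_ord a \<longrightarrow> is_ord b \<longrightarrow> a \<epsilon> b \<or> a = b \<or> b \<epsilon> a" (is "?P a")
  proof (rule eps_induct[where P = ?P, OF _ _ ord_set[OF assms(1)]])
    show "definable (Suc 0) (\<lambda>xs. ?P (hd xs))" by (intro dfn)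
    fix a assume a: "is_set a" and IH: "\<And>x. x \<epsilon> a \<Longrightarrow> ?P x"
    show "?P a"
    proof (intro allI impI)
      fix b assume b: "is_set b" "is_ord b" and oa: "is_ord a"
      have "is_ord b \<longrightarrow> a \<epsilon> b \<or> a = b \<or> b \<epsilon> a" (is "?Q b")
      proof (rule eps_induct[where P = ?Q, OF _ _ b(1)])
        show "definable (Suc 0) (\<lambda>xs. ?Q (hd xs))" by (intro dfn)
        fix b assume b: "is_set b" and IH': "\<And>y. y \<epsilon> b \<Longrightarrow> ?Q y"
        show "?Q b"
        proof (intro impI, rule ccontr)
          assume ob: "is_ord b" and n: "\<not> (a \<epsilon> b \<or> a = b \<or> b \<epsilon> a)"
          have "x \<epsilon> a \<longleftrightarrow> x \<epsilon> b" for x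
            using n IH IH' oa ob b ord_mem ord_trans by metis
          then show False using n eqI by blast
        qed
      qed
      then show "a \<epsilon> b \<or> a = b \<or> b \<epsilon> a" using b by blast
    qed
  qed
  then show ?thesis using assms ord_set by blast
qed

lemma ordI:
  assumes "is_set a" "\<And>x y. x \<epsilon> y \<Longrightarrow> y \<epsilon> a \<Longrightarrow> x \<epsilon> a" "\<And>x. x \<epsilon> a \<Longrightarrow> is_ord x"
  shows "is_ord a"
  unfolding is_ord_iff using assms ord_linear by (meson subI)

lemma ord_succ: "is_ord a \<Longrightarrow> is_ord (succ a)"
  by (rule ordI) (auto simp: mem_succ intro: ord_trans ord_mem ord_set)

lemma mem_self_succ: "is_set a \<Longrightarrow> a \<epsilon> succ a"
  by (simp add: mem_succ)

lemma mem_rank: "y \<epsilon> rank x \<longleftrightarrow> y \<epsilon> V x \<and> is_ord y"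
  unfolding rank_def by (subst mem_Coll, intro dfn) (auto dest: is_setI)

lemma ord_rank: assumes "is_set x" shows "is_ord (rank x)"
proof (rule ordI)
  show "is_set (rank x)" using set_sub[OF V_rec(1)[OF assms]] mem_rank by blast
qed (use assms V_mem_trans ord_mem in \<open>auto simp: mem_rank\<close>)

end

section \<open>Homomorphisms and closed levels\<close>

context GB
begin

lemma is_mapD:
  assumes "is_map h A B"
  shows "is_set h"
    and "x \<epsilon> A \<Longrightarrow> app h x \<epsilon> B" and "x \<epsilon> A \<Longrightarrow> opair x (app h x) \<epsilon> h"
    and "is_set x \<Longrightarrow> is_set y \<Longrightarrow> opair x y \<epsilon> h \<Longrightarrow> x \<epsilon> A \<and> y = app h x"
    and "p \<epsilon> h \<Longrightarrow> \<exists>x. x \<epsilon> A \<and> p = opair x (app h x)"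
proof -
  have h: "is_set h" "\<And>p. p \<epsilon> h \<Longrightarrow> \<exists>x y. x \<epsilon> A \<and> is_set x \<and> is_set y \<and> p = opair x y"
    "\<And>x. x \<epsilon> A \<Longrightarrow> \<exists>!y. is_set x \<and> is_set y \<and> opair x y \<epsilon> h"
    "\<And>x y. is_set x \<Longrightarrow> is_set y \<Longrightarrow> opair x y \<epsilon> h \<Longrightarrow> y \<epsilon> B"
    using assms unfolding is_map_def function_on_def pair_in_iff is_opair_iff by blast+
  show "is_set h" by (rule h)
  have app: "is_set (app h x) \<and> opair x (app h x) \<epsilon> h" if x: "x \<epsilon> A" for x
  proof -
    obtain y where "is_set y" "opair x y \<epsilon> h" "\<And>w. is_set w \<Longrightarrow> opair x w \<epsilon> h \<Longrightarrow> w = y"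
      using h(3)[OF x] is_setI[OF x] by blast
    then show ?thesis using app_eq[OF is_setI[OF x], of y h] by metis
  qed
  show "opair x (app h x) \<epsilon> h" if "x \<epsilon> A" using app[OF that] by blast
  show "app h x \<epsilon> B" if "x \<epsilon> A" using app[OF that] h(4) is_setI[OF that] by blast
  show *: "x \<epsilon> A \<and> y = app h x" if "is_set x" "is_set y" "opair x y \<epsilon> h" for x y
  proof -
    have "x \<epsilon> A" using h(2)[OF that(3)] that(1,2) by auto
    then show ?thesis using h(3) app that by blast
  qed
  show "\<exists>x. x \<epsilon> A \<and> p = opair x (app h x)" if "p \<epsilon> h"
    using h(2)[OF that] * that by blast
qed

lemma is_map_eqI:
  assumes "is_map f A B" "is_map g A B" "\<And>x. x \<epsilon> A \<Longrightarrow> app f x = app g x"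
  shows "f = g"
proof (rule eqI)
  fix p
  show "p \<epsilon> f \<longleftrightarrow> p \<epsilon> g"
    using is_mapD(5)[OF assms(1)] is_mapD(5)[OF assms(2)] is_mapD(3)[OF assms(1)] is_mapD(3)[OF assms(2)]
      assms(3) by metis
qed

lemma is_map_lam:
  assumes f: "dterm (Suc 0) (\<lambda>xs. f (hd xs))" and A: "is_set A" and B: "\<And>x. x \<epsilon> A \<Longrightarrow> f x \<epsilon> B"
  shows "is_map (lam A f) A B"
proof -
  have fs: "is_set (f x)" if "x \<epsilon> A" for x using B[OF that] by (rule is_setI)
  have o: "pair_in (lam A f) x y \<longleftrightarrow> x \<epsilon> A \<and> y = f x" for x y
    unfolding pair_in_iff using opair_lam[OF f fs, of A x y] fs is_setI by blast
  show ?thesis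
    unfolding is_map_def function_on_def o is_opair_iff
  proof (intro conjI allI impI)
    show "is_set (lam A f)" by (rule set_lam[OF f A])
    show "\<exists>x y. x \<epsilon> A \<and> is_set x \<and> is_set y \<and> p = opair x y" if p: "p \<epsilon> lam A f" for p
    proof -
      obtain x where "x \<epsilon> A" "p = opair x (f x)"
        using p unfolding mem_lam[OF f] by blast
      then show ?thesis using fs is_setI by blast
    qed
  qed (use B in auto)
qed

lemma graph_parts_iff:
  "graph_parts g G E \<longleftrightarrow> is_set G \<and> is_set E \<and> g = opair G E \<and> E \<sqsubseteq> cart G G"
proof -
  have "is_opair p v w \<longleftrightarrow> p = opair v w" if "v \<epsilon> G" "w \<epsilon> G" for p v w
    unfolding is_opair_iff using that is_setI by blast
  then have "(\<exists>v w. v \<epsilon> G \<and> w \<epsilon> G \<and> is_opair p v w) \<longleftrightarrow> p \<epsilon> cart G G" for p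
    unfolding mem_cart by blast
  then show ?thesis
    unfolding graph_parts_def is_subclass_def by (simp add: is_opair_iff)
qed

text \<open>Injectivity of pairing recovers vertex and edge sets from the graph, and pairs in
  \<open>h\<close> are read as values of \<open>app\<close>.\<close>

lemma is_hom_iff:
  assumes g: "graph_parts g G E" and g': "graph_parts g' G' E'"
  shows "is_hom h g g' \<longleftrightarrow> is_map h G G' \<and>
    (\<forall>v w. v \<epsilon> G \<longrightarrow> w \<epsilon> G \<longrightarrow> opair v w \<epsilon> E \<longrightarrow> opair (app h v) (app h w) \<epsilon> E')" (is "_ \<longleftrightarrow> ?R")
proof -
  have "is_hom h g g' \<longleftrightarrow> is_map h G G' \<and>
        (\<forall>v w v' w'. pair_in E v w \<and> pair_in h v v' \<and> pair_in h w w' \<longrightarrow> pair_in E' v' w')"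
  proof
    assume "is_hom h g g'"
    then obtain G1 E1 G1' E1' where *: "graph_parts g G1 E1" "graph_parts g' G1' E1'" "is_map h G1 G1'"
      "\<forall>v w v' w'. pair_in E1 v w \<and> pair_in h v v' \<and> pair_in h w w' \<longrightarrow> pair_in E1' v' w'"
      unfolding is_hom_def by blast
    then have "G1 = G" "E1 = E" "G1' = G'" "E1' = E'"
      using g g' unfolding graph_parts_iff by (metis opair_eq_iff)+
    then show "is_map h G G' \<and>
        (\<forall>v w v' w'. pair_in E v w \<and> pair_in h v v' \<and> pair_in h w w' \<longrightarrow> pair_in E' v' w')"
      using * by simp
  qed (use g g' in \<open>unfold is_hom_def, blast\<close>)
  also have "\<dots> \<longleftrightarrow> ?R"
  proof (cases "is_map h G G'")
    case True
    have h: "pair_in h v v' \<longleftrightarrow> v \<epsilon> G \<and> v' = app h v" for v v'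
      unfolding pair_in_iff using is_mapD(2-4)[OF True] is_setI by metis
    have e: "pair_in E v w \<longleftrightarrow> v \<epsilon> G \<and> w \<epsilon> G \<and> opair v w \<epsilon> E" for v w
    proof
      assume vw: "pair_in E v w"
      then obtain v1 w1 where "v1 \<epsilon> G" "w1 \<epsilon> G" "opair v w = opair v1 w1"
        using g unfolding graph_parts_iff pair_in_iff is_subclass_def mem_cart by blast
      moreover from this have "is_set v1" "is_set w1" using is_setI by blast+
      ultimately have "v = v1" "w = w1" "v1 \<epsilon> G" "w1 \<epsilon> G"
        using vw by (simp_all add: pair_in_iff)
      then show "v \<epsilon> G \<and> w \<epsilon> G \<and> opair v w \<epsilon> E" using vw unfolding pair_in_iff by simp
    qed (auto simp: pair_in_iff dest: is_setI)
    have e': "pair_in E' (app h v) (app h w) \<longleftrightarrow> opair (app h v) (app h w) \<epsilon> E'"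
      if "v \<epsilon> G" "w \<epsilon> G" for v w
      unfolding pair_in_iff using is_mapD(2)[OF True] that is_setI by blast
    show ?thesis unfolding h e using True by (auto simp: e')
  qed simp
  finally show ?thesis .
qed

end

section \<open>A counterexample to SWVP and its closed levels\<close>

locale swvp_counterexample = GB_AC mem for mem :: "'c \<Rightarrow> 'c \<Rightarrow> bool" (infix "\<epsilon>" 50) +
  fixes S
  assumes seq: "graph_sequence S"
    and down: "\<And>a b g g'. is_ord a \<Longrightarrow> is_ord b \<Longrightarrow> ord_le a b \<Longrightarrow> pair_in S a g \<Longrightarrow> pair_in S b g' \<Longrightarrow>
      \<exists>h. is_hom h g' g"
    and no_up: "\<And>a b g g'. is_ord a \<Longrightarrow> is_ord b \<Longrightarrow> a \<epsilon> b \<Longrightarrow> pair_in S a g \<Longrightarrow> pair_in S b g' \<Longrightarrow>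
      \<not> (\<exists>h. is_hom h g g')"
begin

definition verts :: "'c \<Rightarrow> 'c" where "verts a = fst_class (app S a)"

definition edges :: "'c \<Rightarrow> 'c" where "edges a = snd_class (app S a)"

lemma dterm_verts [dfn]: "dterm n t \<Longrightarrow> dterm n (\<lambda>xs. verts (t xs))"
  unfolding verts_def by (intro dfn)

lemma dterm_edges [dfn]: "dterm n t \<Longrightarrow> dterm n (\<lambda>xs. edges (t xs))"
  unfolding edges_def by (intro dfn)

lemma pair_in_S:
  assumes "is_ord a" shows "pair_in S a (app S a)"
proof -
  obtain g where g: "pair_in S a g" "\<And>y. pair_in S a y \<Longrightarrow> y = g"
    using seq assms unfolding graph_sequence_def function_on_def by blast
  have a: "is_set a" "is_set g" "opair a g \<epsilon> S" using g(1) unfolding pair_in_iff by blast+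
  have "app S a = g" 
  proof (rule app_eq[OF a])
    show "w = g" if "is_set w" "opair a w \<epsilon> S" for w
      using g(2)[of w] a that unfolding pair_in_iff by blast
  qed
  then show ?thesis using g(1) by simp
qed

lemma parts:
  assumes "is_ord a" shows "graph_parts (app S a) (verts a) (edges a)"
proof -
  obtain G E where "graph_parts (app S a) G E"
    using seq pair_in_S[OF assms] unfolding graph_sequence_def is_graph_def by blast
  then have "graph_parts (app S a) G E \<and> verts a = G \<and> edges a = E"
    unfolding verts_def edges_def graph_parts_iff by simp
  then show ?thesis by simp
qed

lemma set_verts: "is_ord a \<Longrightarrow> is_set (verts a)"
  using parts by (auto simp: graph_parts_iff)

text \<open>Placing \<open>h\<close> in a power set bounds the candidates by a set, as the axiom of
  choice will require.\<close>

lemma down_hom: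
  assumes "is_ord a" "is_ord b" "ord_le a b"
  shows "\<exists>h. h \<epsilon> Pow_class (cart (verts b) (verts a)) \<and> (\<forall>v. v \<epsilon> verts b \<longrightarrow> app h v \<epsilon> verts a) \<and>
    (\<forall>v. v \<epsilon> verts b \<longrightarrow> (\<forall>w. w \<epsilon> verts b \<longrightarrow> opair v w \<epsilon> edges b \<longrightarrow> opair (app h v) (app h w) \<epsilon> edges a))"
proof -
  obtain h where "is_hom h (app S b) (app S a)"
    using down assms pair_in_S by blast
  then have h: "is_map h (verts b) (verts a)"
    "\<forall>v w. v \<epsilon> verts b \<longrightarrow> w \<epsilon> verts b \<longrightarrow> opair v w \<epsilon> edges b \<longrightarrow> opair (app h v) (app h w) \<epsilon> edges a"
    using is_hom_iff[OF parts[OF assms(2)] parts[OF assms(1)]] by blast+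
  have "h \<sqsubseteq> cart (verts b) (verts a)"
    using is_mapD(2,5)[OF h(1)] by (intro subI) (metis mem_cart)
  then show ?thesis using h is_mapD(1,2)[OF h(1)] by (intro exI[of _ h]) (simp add: mem_Pow_class)
qed

text \<open>The form in which the contradiction is reached: by replacement, a definable vertex map
  becomes a set, hence a forbidden homomorphism.\<close>

lemma no_up_fun:
  assumes "is_ord a" "is_ord b" "a \<epsilon> b"
    and f: "dterm (Suc 0) (\<lambda>xs. f (hd xs))" "\<And>v. v \<epsilon> verts a \<Longrightarrow> f v \<epsilon> verts b"
    and "\<And>v w. v \<epsilon> verts a \<Longrightarrow> w \<epsilon> verts a \<Longrightarrow> opair v w \<epsilon> edges a \<Longrightarrow> opair (f v) (f w) \<epsilon> edges b"
  shows False
proof -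
  have "app (lam (verts a) f) v = f v" if "v \<epsilon> verts a" for v
    using app_lam[OF f(1) _ that] f(2) is_setI by blast
  then have "is_hom (lam (verts a) f) (app S a) (app S b)"
    unfolding is_hom_iff[OF parts[OF assms(1)] parts[OF assms(2)]]
    using is_map_lam[OF f(1) set_verts[OF assms(1)] f(2)] assms(6) by metis
  then show False using no_up[OF assms(1-3) pair_in_S[OF assms(1)] pair_in_S[OF assms(2)]] by blast
qed

text \<open>\<open>V A = A\<close> singles out the levels of the hierarchy. The last clause keeps in
  \<open>A\<close> the pairs that make up sections over ordinals of \<open>A\<close>; the shift to
  \<open>succ c\<close> lets a value at \<open>d\<close> land in the graph after the
  \<open>d\<close>-th.\<close>

definition closed_level :: "'c \<Rightarrow> bool" where
  "closed_level A \<longleftrightarrow> is_set A \<and> V A = A \<and>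
     (\<forall>c. c \<epsilon> A \<longrightarrow> is_ord c \<longrightarrow> (\<forall>y. y \<epsilon> verts (succ c) \<longrightarrow> opair c y \<epsilon> A))"

definition section_values :: "'c \<Rightarrow> 'c" where
  "section_values W = Union_class (img (\<lambda>c. cart (upair c c) (verts (succ c))) (Coll (\<lambda>c. c \<epsilon> W \<and> is_ord c)))"

definition least_closed_level :: "'c \<Rightarrow> 'c" where
  "least_closed_level z = Coll (\<lambda>x. \<forall>A. is_set A \<longrightarrow> closed_level A \<and> z \<sqsubseteq> A \<longrightarrow> x \<epsilon> A)"

definition level_graph :: "'c" where
  "level_graph = (SOME F. \<forall>x. is_set x \<longrightarrow> is_set (app F x) \<and> app F x = least_closed_level (img (app F) x))"

lemma definable_closed_level [dfn]: "dterm n t \<Longrightarrow> definable n (\<lambda>xs. closed_level (t xs))"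
  unfolding closed_level_def by (intro dfn)

lemma dterm_section_values [dfn]: "dterm n t \<Longrightarrow> dterm n (\<lambda>xs. section_values (t xs))"
  unfolding section_values_def by (intro dfn)

lemma dterm_least_closed_level [dfn]: "dterm n t \<Longrightarrow> dterm n (\<lambda>xs. least_closed_level (t xs))"
  unfolding least_closed_level_def by (intro dfn)

lemma section_values:
  shows "is_set W \<Longrightarrow> is_set (section_values W)"
    and "c \<epsilon> W \<Longrightarrow> is_ord c \<Longrightarrow> y \<epsilon> verts (succ c) \<Longrightarrow> opair c y \<epsilon> section_values W"
proof -
  have d: "dterm (Suc 0) (\<lambda>xs. cart (upair (hd xs) (hd xs)) (verts (succ (hd xs))))" by (intro dfn)
  have o: "c \<epsilon> Coll (\<lambda>c. c \<epsilon> W \<and> is_ord c) \<longleftrightarrow> c \<epsilon> W \<and> is_ord c" for c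
    by (subst mem_Coll, intro dfn) (auto dest: is_setI)
  show "is_set (section_values W)" if "is_set W"
    unfolding section_values_def using o by (intro set_Union_class set_img d set_sub[OF that]) blast
  assume c: "c \<epsilon> W" "is_ord c" "y \<epsilon> verts (succ c)"
  then have "opair c y \<epsilon> cart (upair c c) (verts (succ c))"
    unfolding mem_cart mem_upair using is_setI by blast
  moreover have "is_set (cart (upair c c) (verts (succ c)))"
    using c ord_set set_verts ord_succ by blast
  ultimately show "opair c y \<epsilon> section_values W"
    unfolding section_values_def mem_Union_class mem_img[OF d] o using c by blast
qed

text \<open>Stages are built by recursion on membership; each is a level containing
  \<open>z\<close>, the earlier stages and their section values. The union over the inductive set
  \<open>w\<close> is closed because every stage precedes another one.\<close>

lemma closed_level_ex:
  assumes z: "is_set z" shows "\<exists>A. closed_level A \<and> z \<sqsubseteq> A"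
proof -
  obtain w e where w: "is_set w" "e \<epsilon> w"
    "\<And>x. x \<epsilon> w \<Longrightarrow> \<exists>y. y \<epsilon> w \<and> (\<forall>u. u \<epsilon> y \<longleftrightarrow> u \<epsilon> x \<or> u = x)"
    using infinity by blast
  define H where "H = (\<lambda>u. V (union2 (union2 z (Union_class u)) (section_values (Union_class u))))"
  have "\<exists>F. \<forall>x. is_set x \<longrightarrow> is_set (app F x) \<and> app F x = H (img (app F) x)"
    unfolding H_def by (rule recursion) (intro dfn, assumption+, intro V_rec set_union2 set_Union_class z section_values)
  then obtain F where F: "\<And>x. is_set x \<Longrightarrow> is_set (app F x)" "\<And>x. is_set x \<Longrightarrow> app F x = H (img (app F) x)"
    by blast
  have d: "dterm (Suc 0) (\<lambda>xs. app F (hd xs))" by (intro dfn)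
  have arg: "is_set (union2 (union2 z (Union_class (img (app F) x))) (section_values (Union_class (img (app F) x))))" if "is_set x" for x
    using set_img[OF d that] section_values(1) z by blast
  have Fx: "u \<epsilon> app F x" if "is_set x" "u \<epsilon> union2 (union2 z (Union_class (img (app F) x))) (section_values (Union_class (img (app F) x)))" for u x
    unfolding F(2)[OF that(1)] H_def using sub_V[OF arg[OF that(1)]] that(2) subD by blast
  define A where "A = Union_class (img (app F) w)"
  have A: "u \<epsilon> A \<longleftrightarrow> (\<exists>n. n \<epsilon> w \<and> u \<epsilon> app F n)" for u
    unfolding A_def mem_Union_class mem_img[OF d] using F(1) is_setI by blast
  have setA: "is_set A" unfolding A_def using set_img[OF d w(1)] by blast
  have "z \<sqsubseteq> A"
    using Fx[OF is_setI[OF w(2)]] w(2) A by (intro subI) auto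
  moreover have "V A = A"
  proof (rule eqI)
    fix x assume "is_set x"
    show "x \<epsilon> V A \<longleftrightarrow> x \<epsilon> A"
    proof
      assume "x \<epsilon> V A"
      then obtain y where y: "y \<epsilon> A" "x \<sqsubseteq> V y" using setA by (auto elim: VE)
      then obtain n where n: "n \<epsilon> w" "y \<epsilon> app F n" using A by blast
      have "is_set n" using is_setI[OF n(1)] .
      then have "x \<epsilon> app F n"
        using n(2) V_mono_mem[OF arg] V_sub_closed[OF _ y(2) arg] unfolding F(2)[OF \<open>is_set n\<close>] H_def by blast
      then show "x \<epsilon> A" using A n by blast
    qed (use sub_V[OF setA] subD in blast)
  qed
  moreover have "opair c y \<epsilon> A" if c: "c \<epsilon> A" "is_ord c" "y \<epsilon> verts (succ c)" for c y
  proof -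
    obtain n where n: "n \<epsilon> w" "c \<epsilon> app F n" using A c(1) by blast
    obtain m where m: "m \<epsilon> w" "n \<epsilon> m" using w(3)[OF n(1)] by blast
    then have "c \<epsilon> Union_class (img (app F) m)"
      unfolding mem_Union_class mem_img[OF d] using n(2) F(1) is_setI by blast
    then have "opair c y \<epsilon> app F m"
      using section_values(2)[OF _ c(2,3)] Fx[OF is_setI[OF m(1)]] unfolding mem_union2 by blast
    then show ?thesis using A m by blast
  qed
  ultimately show ?thesis using setA unfolding closed_level_def by blast
qed

text \<open>Each clause of closedness passes to intersections, and \<open>closed_level_ex\<close>
  ensures that the family is nonempty.\<close>

lemma least_closed_level:
  assumes "is_set z" shows "closed_level (least_closed_level z)" "z \<sqsubseteq> least_closed_level z"
proof -
  obtain A0 where A0: "closed_level A0" "z \<sqsubseteq> A0" using closed_level_ex[OF assms] by blast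
  have m: "x \<epsilon> least_closed_level z \<longleftrightarrow> (\<forall>A. closed_level A \<and> z \<sqsubseteq> A \<longrightarrow> x \<epsilon> A)" for x
  proof -
    have "x \<epsilon> least_closed_level z \<longleftrightarrow> is_set x \<and> (\<forall>A. is_set A \<longrightarrow> closed_level A \<and> z \<sqsubseteq> A \<longrightarrow> x \<epsilon> A)"
      unfolding least_closed_level_def by (intro mem_Coll dfn)
    then show ?thesis using A0 is_setI unfolding closed_level_def by blast
  qed
  have set: "is_set (least_closed_level z)"
    by (rule set_sub[of A0]) (use A0 m in \<open>simp_all add: closed_level_def\<close>)
  show "z \<sqsubseteq> least_closed_level z" using m by (auto simp: is_subclass_def)
  have "V (least_closed_level z) = least_closed_level z"
  proof (rule eqI)
    fix x assume "is_set x"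
    show "x \<epsilon> V (least_closed_level z) \<longleftrightarrow> x \<epsilon> least_closed_level z"
    proof
      assume "x \<epsilon> V (least_closed_level z)"
      then obtain y where y: "y \<epsilon> least_closed_level z" "x \<sqsubseteq> V y" using set by (auto elim: VE)
      have "x \<epsilon> A" if "closed_level A" "z \<sqsubseteq> A" for A
        using y m that VI[of y A x] \<open>is_set x\<close> unfolding closed_level_def by metis
      then show "x \<epsilon> least_closed_level z" using m by blast
    qed (use sub_V[OF set] subD in blast)
  qed
  then show "closed_level (least_closed_level z)"
    unfolding closed_level_def using set m unfolding closed_level_def by blast
qed

definition level :: "'c \<Rightarrow> 'c" where "level a = app level_graph a"

lemma dterm_level [dfn]: "dterm n t \<Longrightarrow> dterm n (\<lambda>xs. level (t xs))"
  unfolding level_def by (intro dfn)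

text \<open>Each level is the least closed one including the set of all earlier levels, so the
  sequence increases in the sense of membership.\<close>

lemma level:
  assumes "is_set a" shows "closed_level (level a)" "b \<epsilon> a \<Longrightarrow> level b \<epsilon> level a"
proof -
  have "\<exists>F. \<forall>x. is_set x \<longrightarrow> is_set (app F x) \<and> app F x = least_closed_level (img (app F) x)"
    by (rule recursion) (intro dfn, assumption, use least_closed_level(1) in \<open>auto simp: closed_level_def\<close>)
  from someI_ex[OF this]
  have *: "is_set (app level_graph x) \<and> app level_graph x = least_closed_level (img (app level_graph) x)" if "is_set x" for x
    unfolding level_graph_def using that by blast
  have "level = app level_graph" by (rule ext) (simp add: level_def)
  then have c: "is_set (level x)" "level x = least_closed_level (img level x)" if "is_set x" for x
    using *[OF that] by (metis, metis)
  have d: "dterm (Suc 0) (\<lambda>xs. level (hd xs))" by (intro dfn)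
  show "closed_level (level a)" using least_closed_level(1)[OF set_img[OF d assms]] c(2)[OF assms] by simp
  show "level b \<epsilon> level a" if "b \<epsilon> a"
  proof -
    have "level b \<epsilon> img level a" unfolding mem_img[OF d] using that c(1) is_setI by blast
    then show ?thesis using least_closed_level(2)[OF set_img[OF d assms]] c(2)[OF assms] subD by metis
  qed
qed

end

section \<open>Points and sections\<close>

context GB
begin

lemma dterm_lam [dfn]:
  "dterm (Suc n) (\<lambda>xs. f (tl xs) (hd xs)) \<Longrightarrow> dterm n t \<Longrightarrow> dterm n (\<lambda>xs. lam (t xs) (f xs))"
  unfolding lam_def by (intro dfn dterm_skip)

end

context class_structure
begin

definition is_point :: "'c \<Rightarrow> 'c \<Rightarrow> bool" where
  "is_point A x \<longleftrightarrow> x \<epsilon> A \<or> x = A"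

definition is_part :: "'c \<Rightarrow> 'c \<Rightarrow> bool" where
  "is_part A s \<longleftrightarrow> is_set s \<and> s \<sqsubseteq> A"

text \<open>The disjuncts \<open>= A\<close> for the top point are what makes these relations invariant under truncation.\<close>

definition mem_pt :: "'c \<Rightarrow> 'c \<Rightarrow> 'c \<Rightarrow> bool" where
  "mem_pt A x y \<longleftrightarrow> x \<epsilon> y \<or> y = A"

definition nmem_pt :: "'c \<Rightarrow> 'c \<Rightarrow> 'c \<Rightarrow> bool" where
  "nmem_pt A x y \<longleftrightarrow> \<not> x \<epsilon> y \<or> y = A"

definition mem_part :: "'c \<Rightarrow> 'c \<Rightarrow> 'c \<Rightarrow> bool" where
  "mem_part A x s \<longleftrightarrow> x \<epsilon> s \<or> x = A"

definition nmem_part :: "'c \<Rightarrow> 'c \<Rightarrow> 'c \<Rightarrow> bool" where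
  "nmem_part A x s \<longleftrightarrow> \<not> x \<epsilon> s \<or> x = A"

text \<open>A case distinction written as a comprehension to make it definable;
  \<open>trunc_pt_eq\<close> restores the usual form.\<close>

definition trunc_pt :: "'c \<Rightarrow> 'c \<Rightarrow> 'c" where
  "trunc_pt A x = Coll (\<lambda>z. (x \<epsilon> A \<and> z \<epsilon> x) \<or> (\<not> x \<epsilon> A \<and> z \<epsilon> A))"

end

context GB
begin

lemma definable_sorts [dfn]:
  assumes "dterm n a" "dterm n t"
  shows "definable n (\<lambda>xs. is_point (a xs) (t xs))" "definable n (\<lambda>xs. is_part (a xs) (t xs))"
  unfolding is_point_def is_part_def by (intro dfn assms)+

lemma definable_relations [dfn]:
  assumes "dterm n a" "dterm n t" "dterm n u"
  shows "definable n (\<lambda>xs. mem_pt (a xs) (t xs) (u xs))" "definable n (\<lambda>xs. nmem_pt (a xs) (t xs) (u xs))"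
    "definable n (\<lambda>xs. mem_part (a xs) (t xs) (u xs))" "definable n (\<lambda>xs. nmem_part (a xs) (t xs) (u xs))"
  unfolding mem_pt_def nmem_pt_def mem_part_def nmem_part_def by (intro dfn assms)+

lemma dterm_trunc_pt [dfn]: "dterm n t \<Longrightarrow> dterm n u \<Longrightarrow> dterm n (\<lambda>xs. trunc_pt (t xs) (u xs))"
  unfolding trunc_pt_def by (intro dfn)

lemma trunc_pt_eq: "trunc_pt A x = (if x \<epsilon> A then x else A)"
proof -
  have "z \<epsilon> trunc_pt A x \<longleftrightarrow> (x \<epsilon> A \<and> z \<epsilon> x) \<or> (\<not> x \<epsilon> A \<and> z \<epsilon> A)" for z
    unfolding trunc_pt_def by (subst mem_Coll, intro dfn) (auto dest: is_setI)
  then show ?thesis by (intro eqI) auto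
qed

end

context swvp_counterexample
begin

text \<open>Concerns only pairs of an ordinal below the rank of \<open>x\<close> and a vertex over
  it. Other elements of \<open>s\<close> are arbitrary, so that the relation makes sense for all
  parts.\<close>

definition is_section :: "'c \<Rightarrow> 'c \<Rightarrow> bool" where
  "is_section s x \<longleftrightarrow> (\<forall>c. c \<epsilon> V x \<longrightarrow> is_ord c \<longrightarrow>
     (\<exists>y. y \<epsilon> verts (succ c) \<and> opair c y \<epsilon> s \<and>
        (\<forall>y'. y' \<epsilon> verts (succ c) \<longrightarrow> opair c y' \<epsilon> s \<longrightarrow> y' = y)))"

definition fiberwise :: "'c \<Rightarrow> 'c \<Rightarrow> bool" where
  "fiberwise s s' \<longleftrightarrow> (\<forall>c. is_set c \<longrightarrow> is_ord c \<longrightarrow>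
     (\<forall>y. y \<epsilon> verts (succ c) \<longrightarrow> (\<forall>y'. y' \<epsilon> verts (succ c) \<longrightarrow>
        opair c y \<epsilon> s \<longrightarrow> opair c y' \<epsilon> s' \<longrightarrow> opair y y' \<epsilon> edges (succ c))))"

lemma definable_is_section [dfn]: "dterm n t \<Longrightarrow> dterm n u \<Longrightarrow> definable n (\<lambda>xs. is_section (t xs) (u xs))"
  unfolding is_section_def by (intro dfn)

lemma definable_fiberwise [dfn]: "dterm n t \<Longrightarrow> dterm n u \<Longrightarrow> definable n (\<lambda>xs. fiberwise (t xs) (u xs))"
  unfolding fiberwise_def by (intro dfn)

definition homs :: "'c \<Rightarrow> 'c \<Rightarrow> 'c" where
  "homs b a = Coll (\<lambda>h. h \<epsilon> Pow_class (cart (verts b) (verts a)) \<and> (\<forall>v. v \<epsilon> verts b \<longrightarrow> app h v \<epsilon> verts a) \<and>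
    (\<forall>v. v \<epsilon> verts b \<longrightarrow> (\<forall>w. w \<epsilon> verts b \<longrightarrow> opair v w \<epsilon> edges b \<longrightarrow> opair (app h v) (app h w) \<epsilon> edges a)))"

lemma dterm_homs [dfn]: "dterm n t \<Longrightarrow> dterm n u \<Longrightarrow> dterm n (\<lambda>xs. homs (t xs) (u xs))"
  unfolding homs_def by (intro dfn)

lemma mem_homs:
  "h \<epsilon> homs b a \<longleftrightarrow> h \<epsilon> Pow_class (cart (verts b) (verts a)) \<and> (\<forall>v. v \<epsilon> verts b \<longrightarrow> app h v \<epsilon> verts a) \<and>
    (\<forall>v. v \<epsilon> verts b \<longrightarrow> (\<forall>w. w \<epsilon> verts b \<longrightarrow> opair v w \<epsilon> edges b \<longrightarrow> opair (app h v) (app h w) \<epsilon> edges a))"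
  unfolding homs_def by (subst mem_Coll, intro dfn) (auto dest: is_setI)

text \<open>Choice is applied to the set of all \<open>homs d (succ c)\<close>, so \<open>f\<close>
  is evaluated at these sets and not at \<open>c\<close>. They are nonempty since
  \<open>succ c\<close> is at most \<open>d\<close>.\<close>

lemma choose_homs:
  assumes d: "is_ord d"
  obtains f where "\<And>c. c \<epsilon> d \<Longrightarrow> app f (homs d (succ c)) \<epsilon> homs d (succ c)"
proof -
  have ne: "\<exists>h. h \<epsilon> homs d (succ c)" "is_set (homs d (succ c))" if "c \<epsilon> d" for c
  proof -
    have c: "is_ord c" using ord_mem[OF d that] .
    have "\<not> d \<epsilon> succ c" using that mem_asym mem_irrefl by (auto simp: mem_succ)
    then have "ord_le (succ c) d" using ord_linear[OF ord_succ[OF c] d] unfolding ord_le_def by blast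
    then show "\<exists>h. h \<epsilon> homs d (succ c)"
      unfolding mem_homs using down_hom[OF ord_succ[OF c] d] by blast
    have "is_set (Pow_class (cart (verts d) (verts (succ c))))"
      using set_verts d ord_succ[OF c] by blast
    then show "is_set (homs d (succ c))"
      by (rule set_sub) (simp add: mem_homs)
  qed
  have t: "dterm (Suc 0) (\<lambda>xs. homs d (succ (hd xs)))" by (intro dfn)
  define a where "a = img (\<lambda>c. homs d (succ c)) d"
  have a: "x \<epsilon> a \<longleftrightarrow> (\<exists>c. c \<epsilon> d \<and> x = homs d (succ c))" for x
    unfolding a_def mem_img[OF t] using ne(2) by blast
  obtain f where f: "function_on f (\<lambda>x. x \<epsilon> a)" "\<And>x y. pair_in f x y \<Longrightarrow> y \<epsilon> x"
    using choice[of a] ne(1) a set_img[OF t ord_set[OF d]] unfolding a_def[symmetric] by metis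
  show thesis
  proof
    fix c assume c: "c \<epsilon> d"
    let ?h = "homs d (succ c)"
    have "?h \<epsilon> a" using a c by blast
    then obtain y where y: "pair_in f ?h y" "\<And>w. pair_in f ?h w \<Longrightarrow> w = y"
      using f(1) unfolding function_on_def by blast
    have "app f ?h = y"
      using y unfolding pair_in_iff by (intro app_eq) blast+
    then show "app f ?h \<epsilon> ?h" using f(2)[OF y(1)] by simp
  qed
qed

lemma is_point_V_sub:
  assumes "closed_level B" "is_point B x" shows "is_set x" "V x \<sqsubseteq> B"
proof -
  have B: "is_set B" "V B = B" using assms unfolding closed_level_def by blast+
  show "is_set x" using assms(2) B is_setI unfolding is_point_def by blast
  have "x \<sqsubseteq> B" using assms(2) V_trans[OF B(1)] B(2) unfolding is_point_def by (auto simp: is_subclass_def)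
  then show "V x \<sqsubseteq> B" using V_sub_mono[of x B] B \<open>is_set x\<close> by simp
qed

text \<open>
  If \<open>V (p x)\<close> were not contained in \<open>V x\<close>, then \<open>d = rank x\<close> would be an index of \<open>p x\<close>. Sending
  a vertex \<open>u\<close> of the \<open>d\<close>-th graph to the section of its images in the graphs \<open>succ c\<close> with
  \<open>c \<epsilon> d\<close>, then applying \<open>q\<close> and reading off the value at \<open>d\<close>, would be a homomorphism from the
  \<open>d\<close>-th graph to the next one.
\<close>

lemma rank_not_raised:
  assumes B: "closed_level B"
    and L: "\<And>s x. is_part B s \<Longrightarrow> is_point B x \<Longrightarrow> is_section s x \<Longrightarrow> is_section (q s) (p x)"
    and E: "\<And>s s'. is_part B s \<Longrightarrow> is_part B s' \<Longrightarrow> fiberwise s s' \<Longrightarrow> fiberwise (q s) (q s')"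
    and q: "\<And>n t. dterm n t \<Longrightarrow> dterm n (\<lambda>xs. q (t xs))"
    and x: "is_point B x" and px: "is_set (p x)"
  shows "V (p x) \<sqsubseteq> V x"
proof (rule ccontr)
  assume "\<not> V (p x) \<sqsubseteq> V x"
  then obtain z where z: "z \<epsilon> V (p x)" "\<not> z \<epsilon> V x" by (auto simp: is_subclass_def)
  have sx: "is_set x" using is_point_V_sub[OF B x] by blast
  define d where "d = rank x"
  have d: "is_ord d" unfolding d_def by (rule ord_rank[OF sx])
  have mem_d: "c \<epsilon> d \<longleftrightarrow> c \<epsilon> V x \<and> is_ord c" for c unfolding d_def mem_rank ..
  have "V z \<epsilon> V (p x)" using V_mono_mem[OF px] z(1) by blast
  \<comment> \<open>As \<open>z\<close> is not in \<open>V x\<close>, comparability of ranks puts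
    \<open>V x\<close> inside \<open>V z\<close>, and \<open>d\<close> consists of elements of
    \<open>V x\<close>.\<close>
  moreover have "d \<sqsubseteq> V z"
    using V_linear[OF sx] z is_setI mem_d unfolding is_subclass_def by blast
  ultimately have d_px: "d \<epsilon> V (p x)" using V_sub_closed px by blast
  obtain f where f: "\<And>c. c \<epsilon> d \<Longrightarrow> app f (homs d (succ c)) \<epsilon> homs d (succ c)"
    using choose_homs[OF d] by blast
  define F where "F u c = app (app f (homs d (succ c))) u" for u c
  have F: "F u c \<epsilon> verts (succ c)" "is_set (F u c)" if "c \<epsilon> d" "u \<epsilon> verts d" for c u
    using f[OF that(1)] that(2) is_setI unfolding mem_homs F_def by blast+
  have F_edges: "opair (F u c) (F w c) \<epsilon> edges (succ c)"
    if "c \<epsilon> d" "u \<epsilon> verts d" "w \<epsilon> verts d" "opair u w \<epsilon> edges d" for c u w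
    using f[OF that(1)] that(2-) unfolding mem_homs F_def by blast
  define s where "s u = lam d (F u)" for u
  have Fd: "dterm (Suc 0) (\<lambda>xs. F u (hd xs))" for u
    unfolding F_def by (intro dfn)
  have s: "opair c y \<epsilon> s u \<longleftrightarrow> c \<epsilon> d \<and> y = F u c" if "u \<epsilon> verts d" "is_set c" "is_set y" for u c y
    unfolding s_def using opair_lam[OF Fd F(2)] that by blast
  have SSs: "is_part B (s u)" if u: "u \<epsilon> verts d" for u
    unfolding is_part_def
  proof (intro conjI subI)
    show "is_set (s u)" unfolding s_def by (rule set_lam[OF Fd ord_set[OF d]])
    fix w assume "w \<epsilon> s u"
    then obtain c where c: "c \<epsilon> d" "w = opair c (F u c)" unfolding s_def mem_lam[OF Fd] by blast
    then have "c \<epsilon> B" using is_point_V_sub(2)[OF B x] mem_d subD by blast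
    \<comment> \<open>Here the closure of \<open>B\<close> under pairs of an ordinal and a vertex
      makes the section a part.\<close>
    then show "w \<epsilon> B" using B F(1)[OF c(1) u] c mem_d unfolding closed_level_def by blast
  qed
  have LLs: "is_section (s u) x" if u: "u \<epsilon> verts d" for u
    unfolding is_section_def
  proof (intro allI impI)
    fix c assume "c \<epsilon> V x" "is_ord c"
    then have c: "c \<epsilon> d" using mem_d by blast
    have "y' = F u c" if "y' \<epsilon> verts (succ c)" "opair c y' \<epsilon> s u" for y'
      using s[OF u is_setI[OF c] is_setI[OF that(1)]] that(2) by blast
    then show "\<exists>y. y \<epsilon> verts (succ c) \<and> opair c y \<epsilon> s u \<and>
        (\<forall>y'. y' \<epsilon> verts (succ c) \<longrightarrow> opair c y' \<epsilon> s u \<longrightarrow> y' = y)"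
      using F[OF c u] s[OF u is_setI[OF c] F(2)[OF c u]] c by blast
  qed
  have EEs: "fiberwise (s u) (s w)" if "u \<epsilon> verts d" "w \<epsilon> verts d" "opair u w \<epsilon> edges d" for u w
    unfolding fiberwise_def
  proof (intro allI impI)
    fix c y y' assume c: "is_set c" "is_ord c" "y \<epsilon> verts (succ c)" "y' \<epsilon> verts (succ c)"
      "opair c y \<epsilon> s u" "opair c y' \<epsilon> s w"
    then have "c \<epsilon> d" "y = F u c" "y' = F w c"
      using s[OF that(1) c(1), of y] s[OF that(2) c(1), of y'] is_setI by blast+
    then show "opair y y' \<epsilon> edges (succ c)" using F_edges that by blast
  qed
  have "\<exists>y. y \<epsilon> verts (succ d) \<and> opair d y \<epsilon> q (s u) \<and>
      (\<forall>y'. y' \<epsilon> verts (succ d) \<longrightarrow> opair d y' \<epsilon> q (s u) \<longrightarrow> y' = y)" if "u \<epsilon> verts d" for u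
    using L[OF SSs[OF that] x LLs[OF that]] d_px d unfolding is_section_def by blast
  then obtain k where k: "\<And>u. u \<epsilon> verts d \<Longrightarrow> k u \<epsilon> verts (succ d)" "\<And>u. u \<epsilon> verts d \<Longrightarrow> opair d (k u) \<epsilon> q (s u)"
      "\<And>u y'. u \<epsilon> verts d \<Longrightarrow> y' \<epsilon> verts (succ d) \<Longrightarrow> opair d y' \<epsilon> q (s u) \<Longrightarrow> y' = k u"
    by metis
  \<comment> \<open>\<open>k\<close> comes from choice in the metatheory and need not be definable.
    Since the value is unique, it is the union of all matching vertices, which is a definable
    term.\<close>
  define val where "val u = Coll (\<lambda>z. \<exists>y. y \<epsilon> verts (succ d) \<and> opair d y \<epsilon> q (s u) \<and> z \<epsilon> y)" for u
  have val: "val u = k u" if "u \<epsilon> verts d" for u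
  proof (rule eqI)
    fix z
    have "z \<epsilon> val u \<longleftrightarrow> is_set z \<and> (\<exists>y. y \<epsilon> verts (succ d) \<and> opair d y \<epsilon> q (s u) \<and> z \<epsilon> y)"
      unfolding val_def by (intro mem_Coll dfn)
    then show "z \<epsilon> val u \<longleftrightarrow> z \<epsilon> k u" using k[OF that] is_setI by blast
  qed
  show False
  proof (rule no_up_fun[OF d ord_succ[OF d] mem_self_succ[OF ord_set[OF d]], of val])
    show "dterm (Suc 0) (\<lambda>xs. val (hd xs))"
      unfolding val_def s_def F_def by (intro dfn q)
    show "val v \<epsilon> verts (succ d)" if "v \<epsilon> verts d" for v using val k that by simp
    show "opair (val v) (val w) \<epsilon> edges (succ d)" if "v \<epsilon> verts d" "w \<epsilon> verts d" "opair v w \<epsilon> edges d" for v w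
      using E[OF SSs[OF that(1)] SSs[OF that(2)] EEs[OF that]] k(1,2)[OF that(1)] k(1,2)[OF that(2)] d ord_set[OF d]
      unfolding fiberwise_def val[OF that(1)] val[OF that(2)] by blast
  qed
qed

text \<open>\<open>p\<close> and \<open>q\<close> are the actions of a homomorphism on points and
  parts. Points are settled by induction on rank, bounded from above by
  \<open>rank_not_raised\<close>; parts then follow through their elements.\<close>

lemma rigid:
  assumes A: "closed_level A" and B: "closed_level B"
    and L: "\<And>s x. is_part B s \<Longrightarrow> is_point B x \<Longrightarrow> is_section s x \<Longrightarrow> is_section (q s) (p x)"
    and E: "\<And>s s'. is_part B s \<Longrightarrow> is_part B s' \<Longrightarrow> fiberwise s s' \<Longrightarrow> fiberwise (q s) (q s')"
    and R: "\<And>x y. is_point B x \<Longrightarrow> is_point B y \<Longrightarrow> mem_pt B x y \<Longrightarrow> mem_pt A (p x) (p y)"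
    and N: "\<And>x y. is_point B x \<Longrightarrow> is_point B y \<Longrightarrow> nmem_pt B x y \<Longrightarrow> nmem_pt A (p x) (p y)"
    and I: "\<And>x s. is_point B x \<Longrightarrow> is_part B s \<Longrightarrow> mem_part B x s \<Longrightarrow> mem_part A (p x) (q s)"
    and J: "\<And>x s. is_point B x \<Longrightarrow> is_part B s \<Longrightarrow> nmem_part B x s \<Longrightarrow> nmem_part A (p x) (q s)"
    and P: "\<And>x. is_point B x \<Longrightarrow> is_point A (p x)" and S: "\<And>s. is_part B s \<Longrightarrow> is_part A (q s)"
    and q: "\<And>n t. dterm n t \<Longrightarrow> dterm n (\<lambda>xs. q (t xs))"
    and p: "\<And>n t. dterm n t \<Longrightarrow> dterm n (\<lambda>xs. p (t xs))"
  shows "is_point B x \<Longrightarrow> p x = trunc_pt A x" and "is_part B s \<Longrightarrow> q s = inter s A" and "\<not> B \<epsilon> A"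
proof -
  have sA: "is_set A" "V A = A" and sB: "is_set B" "V B = B" using A B unfolding closed_level_def by blast+
  have pset: "is_set (p x)" if "is_point B x" for x using is_point_V_sub(1)[OF A P[OF that]] .
  have rank: "V (p x) \<sqsubseteq> V x" if "is_point B x" for x
    using rank_not_raised[where q = q and p = p, OF B L E q that pset[OF that]] .
  have VB: "is_point B z" if "is_point B x" "z \<epsilon> V x" for x z
    using is_point_V_sub(2)[OF B that(1)] that(2) unfolding is_point_def is_subclass_def by blast
  have point: "p x = trunc_pt A x" if x: "is_point B x" for x
  proof -
    have "is_point B x \<longrightarrow> p x = trunc_pt A x"
    proof (rule V_induct[where P = "\<lambda>x. is_point B x \<longrightarrow> p x = trunc_pt A x"])
      show "definable (Suc 0) (\<lambda>xs. is_point B (hd xs) \<longrightarrow> p (hd xs) = trunc_pt A (hd xs))"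
        by (intro dfn p)
      show "is_set x" using is_point_V_sub(1)[OF B x] .
      fix x assume sx: "is_set x" and IH: "\<And>z. z \<epsilon> V x \<Longrightarrow> is_point B z \<longrightarrow> p z = trunc_pt A z"
      have IH: "p z = trunc_pt A z" if "is_point B x" "z \<epsilon> V x" for z using IH VB that by blast
      have xV: "z \<epsilon> V x" if "z \<epsilon> x" for z using sub_V[OF sx] that subD by blast
      have Rx: "trunc_pt A z \<epsilon> p x \<or> p x = A" if "is_point B x" "z \<epsilon> x" for z
        using R[OF VB[OF that(1) xV[OF that(2)]] that(1)] IH[OF that(1) xV[OF that(2)]] that(2)
        unfolding mem_pt_def by simp
      show "is_point B x \<longrightarrow> p x = trunc_pt A x"
      proof
        assume x: "is_point B x"
        show "p x = trunc_pt A x"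
        proof (cases "x \<epsilon> A")
          case True
          have xA: "z \<epsilon> A" if "z \<epsilon> x" for z using V_mem_trans[OF that] True sA by metis
          \<comment> \<open>Otherwise \<open>A = V A\<close> would lie inside \<open>V x\<close>,
            making \<open>x\<close> an element of \<open>V x\<close>.\<close>
          have "p x \<noteq> A"
            using rank[OF x] True sA(2) not_mem_V[OF sx] subD by metis
          then have pxA: "p x \<epsilon> A" using P[OF x] unfolding is_point_def by blast
          have "p x = x"
          proof (rule eqI)
            fix z
            show "z \<epsilon> p x \<longleftrightarrow> z \<epsilon> x"
            proof
              assume "z \<epsilon> x"
              then show "z \<epsilon> p x" using Rx[OF x \<open>z \<epsilon> x\<close>] xA \<open>p x \<noteq> A\<close> by (simp add: trunc_pt_eq)
            next
              assume z: "z \<epsilon> p x"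
              then have zV: "z \<epsilon> V x"
                using sub_V[OF pset[OF x]] rank[OF x] subD by blast
              have "z \<epsilon> A" using V_mem_trans[OF z] pxA sA by metis
              then have "p z = z" using IH[OF x zV] by (simp add: trunc_pt_eq)
              then show "z \<epsilon> x"
                using N[OF VB[OF x zV] x] z \<open>p x \<noteq> A\<close> unfolding nmem_pt_def by auto
            qed
          qed
          then show ?thesis using True by (simp add: trunc_pt_eq)
        next
          case False
          \<comment> \<open>Otherwise \<open>p x\<close> is an element of \<open>A\<close> and
            contains the truncations of the elements of \<open>x\<close>. None of these is the top,
            as that would give \<open>A \<epsilon> A\<close>. So \<open>x\<close> is a subset of
            \<open>p x\<close> and therefore belongs to the level \<open>A\<close>.\<close>
          have "p x = A"
          proof (rule ccontr)
            assume n: "p x \<noteq> A"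
            then have pxA: "p x \<epsilon> A" using P[OF x] unfolding is_point_def by blast
            have "z \<epsilon> p x" if "z \<epsilon> x" for z
            proof -
              have "trunc_pt A z \<epsilon> p x" using Rx[OF x that] n by blast
              moreover from this have "trunc_pt A z \<epsilon> A" using V_mem_trans[of "trunc_pt A z" "p x" A] pxA sA by simp
              ultimately show ?thesis using mem_irrefl[of A] by (auto simp: trunc_pt_eq split: if_splits)
            qed
            then have "x \<sqsubseteq> p x" by (rule subI)
            then have "x \<epsilon> A" using V_sub_closed[of "p x" A x] pxA sA by simp
            then show False using False by blast
          qed
          then show ?thesis using False by (simp add: trunc_pt_eq)
        qed
      qed
    qed
    then show ?thesis using x by blast
  qed
  then show "is_point B x \<Longrightarrow> p x = trunc_pt A x" .
  show nBA: "\<not> B \<epsilon> A"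
  proof
    assume BA: "B \<epsilon> A"
    have PB: "is_point B B" unfolding is_point_def by blast
    \<comment> \<open>The top is \<open>mem_pt\<close>-related to itself, and no set is its own
      element, so the top goes to the top. The rank bound then puts \<open>A\<close> inside
      \<open>B\<close>, and \<open>B \<epsilon> A\<close> would yield
      \<open>B \<epsilon> B\<close>.\<close>
    have "p B = A"
      using R[OF PB PB] mem_irrefl unfolding mem_pt_def by blast
    then show False using rank[OF PB] sA sB BA mem_irrefl subD by metis
  qed
  have AB: "A \<sqsubseteq> B" using V_linear[OF sA(1)] sB nBA unfolding sA(2) by metis
  show "q s = inter s A" if s: "is_part B s"
  proof (rule eqI)
    fix z
    show "z \<epsilon> q s \<longleftrightarrow> z \<epsilon> inter s A"
    proof (cases "z \<epsilon> A")
      case True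
      have z: "is_point B z" using AB True unfolding is_point_def is_subclass_def by blast
      have "p z = z" using point[OF z] True by (simp add: trunc_pt_eq)
      \<comment> \<open>As \<open>p z = z\<close> differs from the top, \<open>I\<close> transfers
        membership in \<open>s\<close> and \<open>J\<close> non-membership, which decides both
        directions.\<close>
      then show ?thesis
        using I[OF z s] J[OF z s] True mem_irrefl[of A] unfolding mem_part_def nmem_part_def by auto
    next
      case False
      then show ?thesis using S[OF s] unfolding is_part_def is_subclass_def by auto
    qed
  qed
qed

end

section \<open>The coding graphs\<close>

context class_structure
begin

primrec num :: "nat \<Rightarrow> 'c" where
  "num 0 = empty"
| "num (Suc n) = succ (num n)"

definition trunc :: "'c \<Rightarrow> nat \<Rightarrow> 'c \<Rightarrow> 'c" where
  "trunc A k x = (if k < 8 then empty else if k < 12 then trunc_pt A x else inter x A)"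

text \<open>The dummy entry \<open>empty\<close> gives each tag below 8 exactly one vertex.\<close>

definition vertex :: "'c \<Rightarrow> nat \<Rightarrow> 'c \<Rightarrow> bool" where
  "vertex A k x \<longleftrightarrow> k < 16 \<and> (if k < 8 then x = empty else if k < 12 then is_point A x else is_part A x)"

end

context GB
begin

lemma set_num [simp]: "is_set (num n)"
  by (induction n) auto

lemma mem_num: "x \<epsilon> num n \<longleftrightarrow> (\<exists>k<n. x = num k)"
  by (induction n) (auto simp: mem_succ less_Suc_eq)

lemma num_inj [simp]: "num m = num n \<longleftrightarrow> m = n"
proof -
  have "num m \<noteq> num n" if "m < n" for m n
    using that mem_num[of "num m" n] mem_irrefl[of "num n"] by metis
  then show ?thesis by (metis nat_neq_iff)
qed

lemma definable_vertex [dfn]: "dterm n a \<Longrightarrow> dterm n t \<Longrightarrow> definable n (\<lambda>xs. vertex (a xs) k (t xs))"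
  unfolding vertex_def by (cases "k < 8"; cases "k < 12"; simp; intro dfn)

lemma dterm_trunc [dfn]: "dterm n a \<Longrightarrow> dterm n t \<Longrightarrow> dterm n (\<lambda>xs. trunc (a xs) k (t xs))"
  unfolding trunc_def by (cases "k < 8"; cases "k < 12"; simp; intro dfn)

lemma vertex_set:
  assumes "is_set A" "\<And>x. x \<epsilon> A \<Longrightarrow> x \<sqsubseteq> A" "vertex A k x"
  shows "x \<epsilon> Pow_class A" "is_set x"
proof -
  show "x \<epsilon> Pow_class A"
    using assms unfolding vertex_def is_point_def is_part_def mem_Pow_class
    by (auto split: if_splits simp: is_subclass_def dest: is_setI)
  then show "is_set x" by (rule is_setI)
qed

end

context swvp_counterexample
begin

text \<open>
  Indices \<open>k < 8\<close> are the vertices of a directed path, whose length forces a homomorphism to fix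
  them; \<open>8 \<le> k < 12\<close> are four copies of the points and \<open>12 \<le> k < 16\<close> four copies of the sections.
  Edges to and from the path identify the copy, and identity edges from the first copy to the
  other three tie the copies together, so that no loops are needed.
\<close>

definition edge :: "'c \<Rightarrow> nat \<Rightarrow> 'c \<Rightarrow> nat \<Rightarrow> 'c \<Rightarrow> bool" where
  "edge A k x l y \<longleftrightarrow>
     (k < 7 \<and> l = Suc k) \<or> (k < 4 \<and> (l = 8 + k \<or> l = 12 + k)) \<or>
     (8 \<le> k \<and> k < 12 \<and> l = 6) \<or> (12 \<le> k \<and> k < 16 \<and> l = 7) \<or>
     (k = 8 \<and> 9 \<le> l \<and> l < 12 \<and> x = y) \<or> (k = 12 \<and> 13 \<le> l \<and> l < 16 \<and> x = y) \<or>
     (k = 9 \<and> l = 10 \<and> mem_pt A x y) \<or> (k = 9 \<and> l = 11 \<and> nmem_pt A x y) \<or>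
     (k = 9 \<and> l = 14 \<and> mem_part A x y) \<or> (k = 9 \<and> l = 15 \<and> nmem_part A x y) \<or>
     (k = 13 \<and> l = 10 \<and> is_section x y) \<or> (k = 13 \<and> l = 14 \<and> fiberwise x y)"

lemma definable_edge [dfn]:
  "dterm n a \<Longrightarrow> dterm n t \<Longrightarrow> dterm n u \<Longrightarrow> definable n (\<lambda>xs. edge (a xs) k (t xs) l (u xs))"
  unfolding edge_def by (intro dfn)

definition code_verts :: "'c \<Rightarrow> 'c" where
  "code_verts A = Coll (\<lambda>v. \<exists>k<16. \<exists>x. is_set x \<and> v = opair (num k) x \<and> vertex A k x)"

definition code_edges :: "'c \<Rightarrow> 'c" where
  "code_edges A = Coll (\<lambda>e. \<exists>k<16. \<exists>l<16. \<exists>x. is_set x \<and> (\<exists>y. is_set y \<and>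
     e = opair (opair (num k) x) (opair (num l) y) \<and> vertex A k x \<and> vertex A l y \<and> edge A k x l y))"

definition code_graph :: "'c \<Rightarrow> 'c" where
  "code_graph A = opair (code_verts A) (code_edges A)"

lemma dterm_code_graph [dfn]: "dterm n t \<Longrightarrow> dterm n (\<lambda>xs. code_graph (t xs))"
  unfolding code_graph_def code_verts_def code_edges_def by (intro dfn)

lemma closed_level_basic:
  assumes "closed_level A" shows "is_set A" "x \<epsilon> A \<Longrightarrow> x \<sqsubseteq> A" "V A = A"
  using assms V_trans unfolding closed_level_def by metis+

lemma closed_level_vertex_set:
  assumes "closed_level A" "vertex A k x" shows "x \<epsilon> Pow_class A" "is_set x" "k < 16"
  using vertex_set[OF closed_level_basic(1)[OF assms(1)] closed_level_basic(2)[OF assms(1)] assms(2)] assms(2)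
  by (auto simp: vertex_def)

lemma mem_code_verts:
  assumes "closed_level A" shows "v \<epsilon> code_verts A \<longleftrightarrow> (\<exists>k x. v = opair (num k) x \<and> vertex A k x)"
proof -
  have "v \<epsilon> code_verts A \<longleftrightarrow> is_set v \<and> (\<exists>k<16. \<exists>x. is_set x \<and> v = opair (num k) x \<and> vertex A k x)"
    unfolding code_verts_def by (intro mem_Coll dfn)
  then show ?thesis using closed_level_vertex_set[OF assms] set_num set_opair by blast
qed

lemma mem_code_edges:
  assumes "closed_level A" "vertex A k x" "vertex A l y"
  shows "opair (opair (num k) x) (opair (num l) y) \<epsilon> code_edges A \<longleftrightarrow> edge A k x l y"
proof -
  note s = closed_level_vertex_set(2,3)[OF assms(1,2)] closed_level_vertex_set(2,3)[OF assms(1,3)]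
  have "e \<epsilon> code_edges A \<longleftrightarrow> is_set e \<and> (\<exists>k<16. \<exists>l<16. \<exists>x. is_set x \<and> (\<exists>y. is_set y \<and>
     e = opair (opair (num k) x) (opair (num l) y) \<and> vertex A k x \<and> vertex A l y \<and> edge A k x l y))" for e
    unfolding code_edges_def by (intro mem_Coll dfn)
  then show ?thesis using s assms(2,3) by auto
qed

lemma graph_parts_code_graph:
  assumes A: "closed_level A" shows "graph_parts (code_graph A) (code_verts A) (code_edges A)"
proof -
  have 1: "is_set (code_verts A)"
  proof (rule set_sub)
    show "is_set (cart (num 16) (Pow_class A))" by (intro set_cart set_Pow_class set_num closed_level_basic(1)[OF A])
    show "v \<epsilon> cart (num 16) (Pow_class A)" if "v \<epsilon> code_verts A" for v
      using that closed_level_vertex_set[OF A] unfolding mem_code_verts[OF A] mem_cart mem_num by blast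
  qed
  have 2: "code_edges A \<sqsubseteq> cart (code_verts A) (code_verts A)"
  proof (rule subI)
    fix e assume "e \<epsilon> code_edges A"
    then have "\<exists>k<16. \<exists>l<16. \<exists>x. is_set x \<and> (\<exists>y. is_set y \<and>
     e = opair (opair (num k) x) (opair (num l) y) \<and> vertex A k x \<and> vertex A l y \<and> edge A k x l y)"
      unfolding code_edges_def by (subst (asm) mem_Coll, intro dfn) blast
    then show "e \<epsilon> cart (code_verts A) (code_verts A)"
      unfolding mem_cart mem_code_verts[OF A] by blast
  qed
  then have "is_set (code_edges A)" using set_sub[OF set_cart[OF 1 1]] subD by blast
  then show ?thesis unfolding graph_parts_iff code_graph_def using 1 2 by blast
qed

text \<open>The disjuncts for the top absorb every point pushed outside \<open>A\<close>. Sections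
  survive because, for \<open>c\<close> in \<open>A\<close>, the pairs that matter already lie in
  \<open>A\<close>.\<close>

lemma truncation:
  assumes A: "closed_level A" and B: "closed_level B" and AB: "ord_le A B"
  shows "vertex B k x \<Longrightarrow> vertex A k (trunc A k x)"
    and "vertex B k x \<Longrightarrow> vertex B l y \<Longrightarrow> edge B k x l y \<Longrightarrow> edge A k (trunc A k x) l (trunc A l y)"
proof -
  note sA = closed_level_basic(1)[OF A] closed_level_basic(3)[OF A] and sB = closed_level_basic(1)[OF B] closed_level_basic(3)[OF B]
  have tA: "y \<epsilon> A" if "y \<epsilon> x" "x \<epsilon> A" for x y using closed_level_basic(2)[OF A that(2)] that(1) subD by blast
  show "vertex A k (trunc A k x)" if "vertex B k x"
    using that sA set_inter1[of x A] by (auto simp: vertex_def trunc_def is_point_def is_part_def trunc_pt_eq is_subclass_def)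
  have nBA: "\<not> B \<epsilon> A" using AB mem_asym mem_irrefl unfolding ord_le_def by blast
  have cut: "opair c y \<epsilon> inter s A \<longleftrightarrow> opair c y \<epsilon> s" if "c \<epsilon> A" "is_ord c" "y \<epsilon> verts (succ c)" for c y s
    using A that unfolding closed_level_def by simp
  have R: "mem_pt A (trunc_pt A x) (trunc_pt A y)" if "mem_pt B x y" for x y
    using that nBA tA unfolding mem_pt_def trunc_pt_eq by auto
  have N: "nmem_pt A (trunc_pt A x) (trunc_pt A y)" if "nmem_pt B x y" for x y
    using that nBA mem_asym[of y A] unfolding nmem_pt_def trunc_pt_eq by auto
  have I: "mem_part A (trunc_pt A x) (inter s A)" if "mem_part B x s" for x s
    using that nBA unfolding mem_part_def trunc_pt_eq by auto
  have J: "nmem_part A (trunc_pt A x) (inter s A)" if "nmem_part B x s" for x s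
    using that nBA unfolding nmem_part_def trunc_pt_eq by auto
  have E: "fiberwise (inter s A) (inter s' A)" if "fiberwise s s'" for s s'
    using that unfolding fiberwise_def by simp
  have L: "is_section (inter s A) (trunc_pt A x)" if "is_section s x" "is_point B x" for s x
    unfolding is_section_def
  proof (intro allI impI)
    fix c assume c: "c \<epsilon> V (trunc_pt A x)" "is_ord c"
    have "is_set x" using is_point_V_sub(1)[OF B \<open>is_point B x\<close>] .
    \<comment> \<open>A point is either kept or has at least the rank of \<open>A\<close>; in both
      cases truncation tests no new ordinals.\<close>
    have "c \<epsilon> A \<and> c \<epsilon> V x"
    proof (cases "x \<epsilon> A")
      case True
      then have "V x \<epsilon> A" using V_mono_mem[OF sA(1)] sA(2) by simp
      then show ?thesis using c True tA by (simp add: trunc_pt_eq)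
    next
      case False
      then have "A \<sqsubseteq> V x" using V_linear[OF sA(1)] sA(2) \<open>is_set x\<close> by simp
      then show ?thesis using c(1) False sA(2) by (auto simp: trunc_pt_eq is_subclass_def)
    qed
    then show "\<exists>y. y \<epsilon> verts (succ c) \<and> opair c y \<epsilon> inter s A \<and>
        (\<forall>y'. y' \<epsilon> verts (succ c) \<longrightarrow> opair c y' \<epsilon> inter s A \<longrightarrow> y' = y)"
      using \<open>is_section s x\<close> cut c(2) unfolding is_section_def by metis
  qed
  show "edge A k (trunc A k x) l (trunc A l y)" if xy: "vertex B k x" "vertex B l y" "edge B k x l y"
    using xy(3) unfolding edge_def
    by (elim disjE conjE) (use xy(1,2) R N I J E L in \<open>auto simp: trunc_def vertex_def\<close>)
qed

definition trunc_fun :: "'c \<Rightarrow> 'c \<Rightarrow> 'c" where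
  "trunc_fun A v = Coll (\<lambda>z. \<exists>k<16. \<exists>x. is_set x \<and> v = opair (num k) x \<and> z \<epsilon> opair (num k) (trunc A k x))"

lemma trunc_fun:
  assumes "is_set x" "k < 16"
  shows "trunc_fun A (opair (num k) x) = opair (num k) (trunc A k x)"
proof (rule eqI)
  fix z
  have "z \<epsilon> trunc_fun A (opair (num k) x) \<longleftrightarrow> is_set z \<and> (\<exists>l<16. \<exists>y. is_set y \<and>
      opair (num k) x = opair (num l) y \<and> z \<epsilon> opair (num l) (trunc A l y))"
    unfolding trunc_fun_def by (intro mem_Coll dfn)
  then show "z \<epsilon> trunc_fun A (opair (num k) x) \<longleftrightarrow> z \<epsilon> opair (num k) (trunc A k x)"
    using assms by (auto dest: is_setI)
qed

lemma truncation_hom: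
  assumes A: "closed_level A" and B: "closed_level B" and AB: "ord_le A B"
  shows "\<exists>h. is_hom h (code_graph B) (code_graph A)"
proof -
  note pB = graph_parts_code_graph[OF B] and pA = graph_parts_code_graph[OF A]
  have d: "dterm (Suc 0) (\<lambda>xs. trunc_fun A (hd xs))"
    unfolding trunc_fun_def by (intro dfn)
  have setB: "is_set (code_verts B)" using pB unfolding graph_parts_iff by blast
  have f: "trunc_fun A (opair (num k) x) = opair (num k) (trunc A k x)" if "vertex B k x" for k x
    using trunc_fun closed_level_vertex_set[OF B that] by blast
  have into: "trunc_fun A v \<epsilon> code_verts A" if "v \<epsilon> code_verts B" for v
    using that f truncation(1)[OF assms] unfolding mem_code_verts[OF A] mem_code_verts[OF B] by blast
  have val: "app (lam (code_verts B) (trunc_fun A)) v = trunc_fun A v" if "v \<epsilon> code_verts B" for v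
    using app_lam[OF d _ that] into is_setI by blast
  have "opair (trunc_fun A v) (trunc_fun A w) \<epsilon> code_edges A"
    if vw: "v \<epsilon> code_verts B" "w \<epsilon> code_verts B" "opair v w \<epsilon> code_edges B" for v w
  proof -
    obtain k x l y where v: "v = opair (num k) x" "vertex B k x" and w: "w = opair (num l) y" "vertex B l y"
      using vw(1,2) unfolding mem_code_verts[OF B] by blast
    then have "edge B k x l y" using vw(3) mem_code_edges[OF B] by blast
    then show ?thesis
      using f v w truncation[OF assms] mem_code_edges[OF A] by metis
  qed
  then have "is_hom (lam (code_verts B) (trunc_fun A)) (code_graph B) (code_graph A)"
    unfolding is_hom_iff[OF pB pA] using is_map_lam[OF d setB into] val by metis
  then show ?thesis by blast
qed

section \<open>Rigidity of the coding graphs\<close>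

definition height :: "nat \<Rightarrow> nat" where
  "height k = (if k < 8 then k else if k < 12 then k - 6 else k - 10)"

text \<open>The grading takes values 0 to 7, so a directed path with eight vertices has to pass
  through all heights in order.\<close>

lemma edge_height: "edge A k x l y \<Longrightarrow> k < 16 \<Longrightarrow> l < 16 \<Longrightarrow> height k < height l"
  unfolding edge_def height_def by auto

text \<open>\<open>\<kappa>\<close> and \<open>\<xi>\<close> are tag and entry of the image vertex.
  Heights fix the path, edges from and to the path fix the other tags, and identity edges make the
  entry independent of the copy.\<close>

lemma copies_fixed:
  assumes A: "closed_level A" and B: "closed_level B"
    and V: "\<And>k x. vertex B k x \<Longrightarrow> vertex A (\<kappa> k x) (\<xi> k x)"
    and E: "\<And>k x l y. vertex B k x \<Longrightarrow> vertex B l y \<Longrightarrow> edge B k x l y \<Longrightarrow>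
      edge A (\<kappa> k x) (\<xi> k x) (\<kappa> l y) (\<xi> l y)"
  shows "vertex B k x \<Longrightarrow> \<kappa> k x = k"
    and "8 \<le> k \<Longrightarrow> k < 12 \<Longrightarrow> is_point B x \<Longrightarrow> \<xi> k x = \<xi> 8 x"
    and "12 \<le> k \<Longrightarrow> k < 16 \<Longrightarrow> is_part B x \<Longrightarrow> \<xi> k x = \<xi> 12 x"
proof -
  have lt: "\<kappa> k x < 16" if "vertex B k x" for k x using V[OF that] unfolding vertex_def by blast
  have vt: "vertex B j empty" if "j < 8" for j using that unfolding vertex_def by simp
  define t where "t j = \<kappa> j empty" for j
  have t16: "t j < 16" if "j < 8" for j using lt[OF vt[OF that]] unfolding t_def .
  have path: "edge A (t j) (\<xi> j empty) (t (Suc j)) (\<xi> (Suc j) empty)" if "j < 7" for j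
    using E[of j empty "Suc j" empty] vt that unfolding t_def edge_def[of B] by simp
  have up: "height (t j) < height (t (Suc j))" if "j < 7" for j
    using edge_height[OF path[OF that]] t16 that by simp
  have "height (t 7) \<le> 7" using t16[of 7] unfolding height_def by auto
  then have htt: "height (t j) = j" if "j < 8" for j
    using up[of 0] up[of 1] up[of 2] up[of 3] up[of 4] up[of 5] up[of 6] that
    by (auto simp: less_Suc_eq numeral_eq_Suc)
  have t: "j < 8 \<Longrightarrow> t j = j" for j
  proof (induction j)
    case 0
    show ?case using htt[of 0] t16[of 0] unfolding height_def by (auto split: if_splits)
  next
    case (Suc j)
    then show ?case
      \<comment> \<open>From tag \<open>j\<close> edges lead to \<open>Suc j\<close> and at most
        also to copies of height \<open>j + 2\<close>; the known height leaves the former.\<close>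
      using path[of j] htt[of "Suc j"] unfolding edge_def height_def by (auto split: if_splits)
  qed
  show fixed: "\<kappa> k x = k" if kx: "vertex B k x" for k x
  proof -
    consider "k < 8" | "8 \<le> k" "k < 12" | "12 \<le> k" "k < 16" using kx unfolding vertex_def by linarith
    then show ?thesis
    proof cases
      case 1
      then show ?thesis using kx t[OF 1] unfolding vertex_def t_def by simp
    next
      case 2
      \<comment> \<open>Only tag \<open>k\<close> both receives an edge from tag
        \<open>k - 8\<close> and sends one to tag 6. For parts, \<open>k - 12\<close> and tag 7 play
        these roles.\<close>
      have "edge A (t (k - 8)) (\<xi> (k - 8) empty) (\<kappa> k x) (\<xi> k x)" "edge A (\<kappa> k x) (\<xi> k x) (t 6) (\<xi> 6 empty)"
        using 2 unfolding t_def by (intro E vt kx; auto simp: edge_def)+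
      then show ?thesis using 2 lt[OF kx] t[of "k - 8"] t[of 6] unfolding edge_def by auto
    next
      case 3
      have "edge A (t (k - 12)) (\<xi> (k - 12) empty) (\<kappa> k x) (\<xi> k x)" "edge A (\<kappa> k x) (\<xi> k x) (t 7) (\<xi> 7 empty)"
        using 3 unfolding t_def by (intro E vt kx; auto simp: edge_def)+
      then show ?thesis using 3 lt[OF kx] t[of "k - 12"] t[of 7] unfolding edge_def by auto
    qed
  qed
  show "\<xi> k x = \<xi> 8 x" if "8 \<le> k" "k < 12" "is_point B x"
  proof (cases "k = 8")
    case False
    have v: "vertex B 8 x" "vertex B k x" using that unfolding vertex_def by simp_all
    have "edge A 8 (\<xi> 8 x) k (\<xi> k x)"
      using E[OF v] fixed[OF v(1)] fixed[OF v(2)] that False unfolding edge_def[of B] by simp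
    then show ?thesis using that False unfolding edge_def by auto
  qed simp
  show "\<xi> k x = \<xi> 12 x" if "12 \<le> k" "k < 16" "is_part B x"
  proof (cases "k = 12")
    case False
    have v: "vertex B 12 x" "vertex B k x" using that unfolding vertex_def by simp_all
    have "edge A 12 (\<xi> 12 x) k (\<xi> k x)"
      using E[OF v] fixed[OF v(1)] fixed[OF v(2)] that False unfolding edge_def[of B] by simp
    then show ?thesis using that False unfolding edge_def by auto
  qed simp
qed

text \<open>Once the tags are fixed, the homomorphism is described by \<open>\<xi> 8\<close> on
  points and \<open>\<xi> 12\<close> on parts, to which \<open>rigid\<close> applies.\<close>

lemma hom_is_truncation:
  assumes A: "closed_level A" and B: "closed_level B" and h: "is_hom h (code_graph B) (code_graph A)"
  shows "vertex B k x \<Longrightarrow> app h (opair (num k) x) = opair (num k) (trunc A k x)" and "\<not> B \<epsilon> A"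
proof -
  have hm: "is_map h (code_verts B) (code_verts A)"
    and harc: "\<And>v w. v \<epsilon> code_verts B \<Longrightarrow> w \<epsilon> code_verts B \<Longrightarrow> opair v w \<epsilon> code_edges B \<Longrightarrow> opair (app h v) (app h w) \<epsilon> code_edges A"
    using h unfolding is_hom_iff[OF graph_parts_code_graph[OF B] graph_parts_code_graph[OF A]] by blast+
  have "\<exists>l y. app h (opair (num k) x) = opair (num l) y \<and> vertex A l y" if "vertex B k x" for k x
    using is_mapD(2)[OF hm, of "opair (num k) x"] that unfolding mem_code_verts[OF A] mem_code_verts[OF B] by blast
  then obtain \<kappa> \<xi>' where \<kappa>: "\<And>k x. vertex B k x \<Longrightarrow> app h (opair (num k) x) = opair (num (\<kappa> k x)) (\<xi>' k x)"
    "\<And>k x. vertex B k x \<Longrightarrow> vertex A (\<kappa> k x) (\<xi>' k x)" by metis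
  \<comment> \<open>\<open>\<xi>'\<close> comes from choice in the metatheory, whereas
    \<open>rigid\<close> requires definable actions; reading off the second component of the image
    provides one.\<close>
  define \<xi> where "\<xi> k x = snd_class (app h (opair (num k) x))" for k x
  have \<xi>: "\<xi> k x = \<xi>' k x" if "vertex B k x" for k x
    unfolding \<xi>_def using \<kappa>(1)[OF that] closed_level_vertex_set(2)[OF A \<kappa>(2)[OF that]] by simp
  have hv: "app h (opair (num k) x) = opair (num (\<kappa> k x)) (\<xi> k x)" "vertex A (\<kappa> k x) (\<xi> k x)"
    if "vertex B k x" for k x
    using \<kappa>[OF that] \<xi>[OF that] by simp_all
  have he: "edge A (\<kappa> k x) (\<xi> k x) (\<kappa> l y) (\<xi> l y)"
    if v: "vertex B k x" "vertex B l y" and e: "edge B k x l y" for k x l y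
  proof -
    have "opair (num k) x \<epsilon> code_verts B" "opair (num l) y \<epsilon> code_verts B" using v mem_code_verts[OF B] by blast+
    moreover have "opair (opair (num k) x) (opair (num l) y) \<epsilon> code_edges B" using mem_code_edges[OF B v] e by blast
    ultimately have "opair (app h (opair (num k) x)) (app h (opair (num l) y)) \<epsilon> code_edges A" by (rule harc)
    then show ?thesis
      using mem_code_edges[OF A hv(2)[OF v(1)] hv(2)[OF v(2)]] hv(1)[OF v(1)] hv(1)[OF v(2)] by simp
  qed
  have fixed: "vertex B k x \<Longrightarrow> \<kappa> k x = k" "8 \<le> k \<Longrightarrow> k < 12 \<Longrightarrow> is_point B x \<Longrightarrow> \<xi> k x = \<xi> 8 x"
    "12 \<le> k \<Longrightarrow> k < 16 \<Longrightarrow> is_part B x \<Longrightarrow> \<xi> k x = \<xi> 12 x" for k x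
    by (rule copies_fixed[where \<kappa> = \<kappa> and \<xi> = \<xi>, OF A B]; (assumption | rule hv(2) he)+)+
  have vP: "vertex B k x" if "8 \<le> k" "k < 12" "is_point B x" for k x using that unfolding vertex_def by simp
  have vS: "vertex B k x" if "12 \<le> k" "k < 16" "is_part B x" for k x using that unfolding vertex_def by simp
  have ePP: "edge A k (\<xi> 8 x) l (\<xi> 8 y)"
    if "8 \<le> k" "k < 12" "8 \<le> l" "l < 12" "is_point B x" "is_point B y" "edge B k x l y" for k x l y
    using he[OF vP[OF that(1,2,5)] vP[OF that(3,4,6)] that(7)] fixed(1)[OF vP[OF that(1,2,5)]]
      fixed(1)[OF vP[OF that(3,4,6)]] fixed(2)[OF that(1,2,5)] fixed(2)[OF that(3,4,6)] by simp
  have ePS: "edge A k (\<xi> 8 x) l (\<xi> 12 y)"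
    if "8 \<le> k" "k < 12" "12 \<le> l" "l < 16" "is_point B x" "is_part B y" "edge B k x l y" for k x l y
    using he[OF vP[OF that(1,2,5)] vS[OF that(3,4,6)] that(7)] fixed(1)[OF vP[OF that(1,2,5)]]
      fixed(1)[OF vS[OF that(3,4,6)]] fixed(2)[OF that(1,2,5)] fixed(3)[OF that(3,4,6)] by simp
  have eSP: "edge A k (\<xi> 12 x) l (\<xi> 8 y)"
    if "12 \<le> k" "k < 16" "8 \<le> l" "l < 12" "is_part B x" "is_point B y" "edge B k x l y" for k x l y
    using he[OF vS[OF that(1,2,5)] vP[OF that(3,4,6)] that(7)] fixed(1)[OF vS[OF that(1,2,5)]]
      fixed(1)[OF vP[OF that(3,4,6)]] fixed(3)[OF that(1,2,5)] fixed(2)[OF that(3,4,6)] by simp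
  have eSS: "edge A k (\<xi> 12 x) l (\<xi> 12 y)"
    if "12 \<le> k" "k < 16" "12 \<le> l" "l < 16" "is_part B x" "is_part B y" "edge B k x l y" for k x l y
    using he[OF vS[OF that(1,2,5)] vS[OF that(3,4,6)] that(7)] fixed(1)[OF vS[OF that(1,2,5)]]
      fixed(1)[OF vS[OF that(3,4,6)]] fixed(3)[OF that(1,2,5)] fixed(3)[OF that(3,4,6)] by simp
  have d: "dterm n (\<lambda>xs. \<xi> k (t xs))" if "dterm n t" for n t k
    unfolding \<xi>_def using that by (intro dfn)
  have L: "is_section (\<xi> 12 s) (\<xi> 8 x)" if "is_part B s" "is_point B x" "is_section s x" for s x
    using eSP[of 13 10 s x] that unfolding edge_def by simp
  have E: "fiberwise (\<xi> 12 s) (\<xi> 12 s')" if "is_part B s" "is_part B s'" "fiberwise s s'" for s s'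
    using eSS[of 13 14 s s'] that unfolding edge_def by simp
  have R: "mem_pt A (\<xi> 8 x) (\<xi> 8 y)" if "is_point B x" "is_point B y" "mem_pt B x y" for x y
    using ePP[of 9 10 x y] that unfolding edge_def by simp
  have N: "nmem_pt A (\<xi> 8 x) (\<xi> 8 y)" if "is_point B x" "is_point B y" "nmem_pt B x y" for x y
    using ePP[of 9 11 x y] that unfolding edge_def by simp
  have I: "mem_part A (\<xi> 8 x) (\<xi> 12 s)" if "is_point B x" "is_part B s" "mem_part B x s" for x s
    using ePS[of 9 14 x s] that unfolding edge_def by simp
  have J: "nmem_part A (\<xi> 8 x) (\<xi> 12 s)" if "is_point B x" "is_part B s" "nmem_part B x s" for x s
    using ePS[of 9 15 x s] that unfolding edge_def by simp
  have P: "is_point A (\<xi> 8 x)" if "is_point B x" for x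
    using hv(2)[OF vP[OF _ _ that, of 8]] fixed(1)[OF vP[OF _ _ that, of 8]] unfolding vertex_def by simp
  have S: "is_part A (\<xi> 12 s)" if "is_part B s" for s
    using hv(2)[OF vS[OF _ _ that, of 12]] fixed(1)[OF vS[OF _ _ that, of 12]] unfolding vertex_def by simp
  have rig: "is_point B x \<Longrightarrow> \<xi> 8 x = trunc_pt A x" "is_part B x \<Longrightarrow> \<xi> 12 x = inter x A" "\<not> B \<epsilon> A" for x
    by (rule rigid[where p = "\<xi> 8" and q = "\<xi> 12", OF A B]; (assumption | rule L E R N I J P S d)+)+
  show "\<not> B \<epsilon> A" by (rule rig(3))
  show "app h (opair (num k) x) = opair (num k) (trunc A k x)" if v: "vertex B k x"
  proof -
    have "\<xi> k x = trunc A k x"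
    proof -
      consider "k < 8" | "8 \<le> k" "k < 12" "is_point B x" | "12 \<le> k" "k < 16" "is_part B x"
        using v unfolding vertex_def by (auto split: if_splits)
      then show ?thesis
      proof cases
        case 1
        then show ?thesis using hv(2)[OF v] fixed(1)[OF v] unfolding vertex_def trunc_def by simp
      next
        case 2
        then show ?thesis using fixed(2)[OF 2] rig(1)[OF 2(3)] unfolding trunc_def by simp
      next
        case 3
        then show ?thesis using fixed(3)[OF 3] rig(2)[OF 3(3)] unfolding trunc_def by simp
      qed
    qed
    then show ?thesis using hv(1)[OF v] fixed(1)[OF v] by simp
  qed
qed

text \<open>Truncation gives existence along the levels. \<open>hom_is_truncation\<close> gives
  uniqueness and, with the two levels exchanged, excludes homomorphisms upward.\<close>

lemma not_WVP: "\<not> WVP"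
proof -
  define S' where "S' = lam (Coll is_ord) (\<lambda>a. code_graph (level a))"
  have d: "dterm (Suc 0) (\<lambda>xs. code_graph (level (hd xs)))" by (intro dfn)
  have o: "a \<epsilon> Coll is_ord \<longleftrightarrow> is_ord a" for a
    by (subst mem_Coll, intro dfn) (auto dest: ord_set)
  have CLc: "closed_level (level a)" if "is_ord a" for a using level(1) ord_set[OF that] by blast
  have g: "graph_parts (code_graph (level a)) (code_verts (level a)) (code_edges (level a))" if "is_ord a" for a
    by (rule graph_parts_code_graph[OF CLc[OF that]])
  have gs: "is_set (code_graph (level a))" if "is_ord a" for a
    using g[OF that] unfolding graph_parts_iff code_graph_def by blast
  have S': "pair_in S' a g \<longleftrightarrow> is_ord a \<and> g = code_graph (level a)" for a g
    unfolding pair_in_iff S'_def using opair_lam[OF d, of "Coll is_ord" a g] gs o ord_set by blast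
  have "graph_sequence S'"
    unfolding graph_sequence_def function_on_def S' is_opair_iff
  proof (intro conjI allI impI)
    show "\<exists>x y. is_ord x \<and> is_set x \<and> is_set y \<and> p = opair x y" if "p \<epsilon> S'" for p
      using that gs o ord_set unfolding S'_def mem_lam[OF d] by blast
    show "is_graph g" if "is_ord a \<and> g = code_graph (level a)" for a g
      using that graph_parts_code_graph CLc unfolding is_graph_def by blast
  qed auto
  moreover have unique: "\<exists>!h. is_hom h (code_graph (level b)) (code_graph (level a))" if "is_ord a" "is_ord b" "ord_le a b" for a b
  proof -
    have le: "ord_le (level a) (level b)"
      using that level(2)[OF ord_set] unfolding ord_le_def by blast
    note C = CLc[OF that(1)] CLc[OF that(2)]
    show ?thesis
    proof (rule ex_ex1I)
      show "\<exists>h. is_hom h (code_graph (level b)) (code_graph (level a))" by (rule truncation_hom[OF C le])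
      fix h h' assume h: "is_hom h (code_graph (level b)) (code_graph (level a))" "is_hom h' (code_graph (level b)) (code_graph (level a))"
      have m: "is_map h (code_verts (level b)) (code_verts (level a))" "is_map h' (code_verts (level b)) (code_verts (level a))"
        using h unfolding is_hom_iff[OF g[OF that(2)] g[OF that(1)]] by blast+
      show "h = h'"
      proof (rule is_map_eqI[OF m])
        fix v assume "v \<epsilon> code_verts (level b)"
        then show "app h v = app h' v"
          unfolding mem_code_verts[OF C(2)] using hom_is_truncation(1)[OF C h(1)] hom_is_truncation(1)[OF C h(2)]
          by auto
      qed
    qed
  qed
  moreover have none: "\<not> (\<exists>h. is_hom h (code_graph (level a)) (code_graph (level b)))" if "is_ord a" "is_ord b" "a \<epsilon> b" for a b
    using hom_is_truncation(2)[OF CLc[OF that(2)] CLc[OF that(1)]] level(2)[OF ord_set[OF that(2)] that(3)] by blast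
  ultimately show ?thesis
    unfolding WVP_def not_not by (intro exI[of _ S'] conjI allI impI) (auto simp: S')
qed

end

theorem theorem1p4:
  fixes mem :: "'c \<Rightarrow> 'c \<Rightarrow> bool"
  assumes "GB_AC mem"
  shows "class_structure.WVP mem \<longleftrightarrow> class_structure.SWVP mem"
proof -
  interpret GB_AC mem by (rule assms)
  show ?thesis
  proof
    show SWVP if w: WVP
    proof (rule ccontr)
      assume "\<not> SWVP"
      then obtain S where "swvp_counterexample mem S"
        unfolding SWVP_def swvp_counterexample_def swvp_counterexample_axioms_def
        using assms by blast
      then show False using swvp_counterexample.not_WVP w by metis
    qed
    \<comment> \<open>A counterexample to WVP is one to SWVP, as unique existence includes
      existence.\<close>
    show WVP if SWVP
      using that unfolding WVP_def SWVP_def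
      by (elim contrapos_nn exE conjE, intro exI conjI) (assumption | blast)+
  qed
qed

end
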